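(* Let $\Omega$ be a bounded Lipschitz domain, let $\Sigma_h\subset\mathbf{H}(\mathrm{div};\Omega)$ and $U_h\subset H^1_0(\Omega)$ be finite dimensional (conforming finite element) subspaces with chosen bases, and let $\mathsf{A}$, $\mathsf{B}$, $\mathsf{C}$, $\mathsf{M}$ be the matrices associated, respectively, with the bilinear forms $(\boldsymbol{\chi},\boldsymbol{\xi})+(\mathrm{div}\,\boldsymbol{\chi},\mathrm{div}\,\boldsymbol{\xi})$ on $\Sigma_h\times\Sigma_h$, $-(\boldsymbol{\chi},\nabla q)$ on $\Sigma_h\times U_h$, $(\nabla p,\nabla q)$ on $U_h\times U_h$, and $(p,q)$ on $U_h\times U_h$. Then the generalized eigenvalue problem $$\begin{pmatrix}\mathsf{A}&\mathsf{B}^\top\\ \mathsf{B}&\mathsf{C}\end{pmatrix}\begin{pmatrix}\mathsf{x}\\ \mathsf{y}\end{pmatrix}=\mu_h\begin{pmatrix}0&0\\ 0&\mathsf{M}\end{pmatrix}\begin{pmatrix}\mathsf{x}\\ \mathsf{y}\end{pmatrix}$$ has the following two families of eigensolutions: (1) $\mu_h=+\infty$ with multiplicity equal to $\dim\Sigma_h$; (2) a number of positive eigenvalues $\mu_h$ (counted with multiplicity) equal to $\dim U_h$.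
   Context: $(\cdot,\cdot)$ is the $L^2(\Omega)$ (or $L^2(\Omega)^d$) inner product; $\mathbf{H}(\mathrm{div};\Omega)=\{\boldsymbol{\tau}\in L^2(\Omega)^d:\mathrm{div}\,\boldsymbol{\tau}\in L^2(\Omega)\}$. The matrix $\mathsf{B}$ has $\dim U_h$ rows (test functions $q\in U_h$) and $\dim\Sigma_h$ columns. Convention for a generalized eigenvalue problem $\mathcal{A}z=\mu\mathcal{B}z$ with $\mathcal{A}$ invertible and $\mathcal{B}$ singular: $\mu=\infty$ is an eigenvalue with eigenspace $\ker\mathcal{B}$; equivalently one considers $\mathcal{B}z=\nu\mathcal{A}z$, where $\nu=0$ corresponds to $\mu=\infty$ and $\nu\ne0$ to $\mu=1/\nu$. *)

theory Defs
  imports "HOL-Analysis.Analysis" "Jordan_Normal_Form.Matrix_Kernel"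
begin

text \<open>Near each boundary point, the set is the part of a ball lying strictly above the graph of a
  Lipschitz function. The direction \<open>\<nu>\<close> is the vertical one, \<open>x - (inner x \<nu>) *\<^sub>R \<nu>\<close> is the
  horizontal part of \<open>x\<close>, and only the values of \<open>\<gamma>\<close> on the hyperplane orthogonal to \<open>\<nu>\<close> matter.\<close>

definition bounded_lipschitz_domain :: "'a::euclidean_space set \<Rightarrow> bool" where
  "bounded_lipschitz_domain \<Omega> \<longleftrightarrow>
     open \<Omega> \<and> connected \<Omega> \<and> \<Omega> \<noteq> {} \<and> bounded \<Omega> \<and>
     (\<forall>x0 \<in> frontier \<Omega>. \<exists>r>0. \<exists>\<nu> L. \<exists>\<gamma> :: 'a \<Rightarrow> real.
        norm \<nu> = 1 \<and> L-lipschitz_on {y. inner y \<nu> = 0} \<gamma> \<and>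
        \<Omega> \<inter> ball x0 r = {x \<in> ball x0 r. inner x \<nu> > \<gamma> (x - (inner x \<nu>) *\<^sub>R \<nu>)})"

text \<open>Elements of \<open>L\<^sup>2(\<Omega>)\<close> are represented by functions on the whole space, only their values on
  \<open>\<Omega>\<close> up to null sets being relevant. The same definitions serve for scalar functions (with
  \<open>inner\<close> being multiplication on the reals) and for vector fields.\<close>

definition L2 :: "'a::euclidean_space set \<Rightarrow> ('a \<Rightarrow> 'b::euclidean_space) set" where
  "L2 \<Omega> = {f. f \<in> borel_measurable (lebesgue_on \<Omega>) \<and>
               integrable (lebesgue_on \<Omega>) (\<lambda>x. (norm (f x))\<^sup>2)}"

definition L2_inner :: "'a::euclidean_space set \<Rightarrow> ('a \<Rightarrow> 'b::euclidean_space) \<Rightarrow> ('a \<Rightarrow> 'b) \<Rightarrow> real" where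
  "L2_inner \<Omega> f g = (LINT x|lebesgue_on \<Omega>. inner (f x) (g x))"

definition L2_norm :: "'a::euclidean_space set \<Rightarrow> ('a \<Rightarrow> 'b::euclidean_space) \<Rightarrow> real" where
  "L2_norm \<Omega> f = sqrt (L2_inner \<Omega> f f)"

fun Ck :: "nat \<Rightarrow> ('a::euclidean_space \<Rightarrow> real) \<Rightarrow> bool" where
  "Ck 0 f \<longleftrightarrow> continuous_on UNIV f"
| "Ck (Suc k) f \<longleftrightarrow>
     (\<forall>x. f differentiable (at x)) \<and> (\<forall>v. Ck k (\<lambda>x. frechet_derivative f (at x) v))"

definition test_functions :: "'a::euclidean_space set \<Rightarrow> ('a \<Rightarrow> real) set" where
  "test_functions \<Omega> =
     {\<phi>. (\<forall>k. Ck k \<phi>) \<and> compact (closure {x. \<phi> x \<noteq> 0}) \<and> closure {x. \<phi> x \<noteq> 0} \<subseteq> \<Omega>}"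

definition gradient :: "('a::euclidean_space \<Rightarrow> real) \<Rightarrow> 'a \<Rightarrow> 'a" where
  "gradient f x = (\<Sum>b\<in>Basis. frechet_derivative f (at x) b *\<^sub>R b)"

definition has_weak_gradient ::
    "'a::euclidean_space set \<Rightarrow> ('a \<Rightarrow> real) \<Rightarrow> ('a \<Rightarrow> 'a) \<Rightarrow> bool" where
  "has_weak_gradient \<Omega> p g \<longleftrightarrow> g \<in> L2 \<Omega> \<and>
     (\<forall>\<phi>\<in>test_functions \<Omega>. \<forall>b\<in>Basis.
        L2_inner \<Omega> p (\<lambda>x. inner (gradient \<phi> x) b) = - L2_inner \<Omega> (\<lambda>x. inner (g x) b) \<phi>)"

definition has_weak_div ::
    "'a::euclidean_space set \<Rightarrow> ('a \<Rightarrow> 'a) \<Rightarrow> ('a \<Rightarrow> real) \<Rightarrow> bool" where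
  "has_weak_div \<Omega> \<tau> w \<longleftrightarrow> w \<in> L2 \<Omega> \<and>
     (\<forall>\<phi>\<in>test_functions \<Omega>. L2_inner \<Omega> \<tau> (gradient \<phi>) = - L2_inner \<Omega> w \<phi>)"

text \<open>Weak derivatives are unique only almost everywhere on \<open>\<Omega>\<close>, hence the choice of
  a representative.\<close>

definition weak_grad :: "'a::euclidean_space set \<Rightarrow> ('a \<Rightarrow> real) \<Rightarrow> 'a \<Rightarrow> 'a" where
  "weak_grad \<Omega> p = (SOME g. has_weak_gradient \<Omega> p g)"

definition weak_div :: "'a::euclidean_space set \<Rightarrow> ('a \<Rightarrow> 'a) \<Rightarrow> 'a \<Rightarrow> real" where
  "weak_div \<Omega> \<tau> = (SOME w. has_weak_div \<Omega> \<tau> w)"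

definition Hdiv :: "'a::euclidean_space set \<Rightarrow> ('a \<Rightarrow> 'a) set" where
  "Hdiv \<Omega> = {\<tau> \<in> L2 \<Omega>. \<exists>w. has_weak_div \<Omega> \<tau> w}"

definition H1 :: "'a::euclidean_space set \<Rightarrow> ('a \<Rightarrow> real) set" where
  "H1 \<Omega> = {p \<in> L2 \<Omega>. \<exists>g. has_weak_gradient \<Omega> p g}"

text \<open>The closure of the test functions in the norm of \<open>H1\<close>.\<close>

definition H10 :: "'a::euclidean_space set \<Rightarrow> ('a \<Rightarrow> real) set" where
  "H10 \<Omega> = {p \<in> H1 \<Omega>. \<forall>\<epsilon>>0. \<exists>\<phi>\<in>test_functions \<Omega>.
      sqrt ((L2_norm \<Omega> (\<lambda>x. p x - \<phi> x))\<^sup>2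
          + (L2_norm \<Omega> (\<lambda>x. weak_grad \<Omega> p x - gradient \<phi> x))\<^sup>2) < \<epsilon>}"

definition function_subspace :: "('a \<Rightarrow> 'b::real_vector) set \<Rightarrow> bool" where
  "function_subspace V \<longleftrightarrow> (\<lambda>x. 0) \<in> V \<and>
     (\<forall>f\<in>V. \<forall>g\<in>V. (\<lambda>x. f x + g x) \<in> V) \<and> (\<forall>c. \<forall>f\<in>V. (\<lambda>x. c *\<^sub>R f x) \<in> V)"

text \<open>\<open>b 0, \<dots>, b (n - 1)\<close> represent a basis of the subspace of \<open>L\<^sup>2(\<Omega>)\<close> represented by \<open>V\<close>, whose
  dimension is therefore \<open>n\<close>. Independence and spanning are understood in \<open>L\<^sup>2(\<Omega>)\<close>, that is,
  up to equality almost everywhere on \<open>\<Omega>\<close>.\<close>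

definition L2_basis ::
    "'a::euclidean_space set \<Rightarrow> ('a \<Rightarrow> 'b::euclidean_space) set \<Rightarrow> nat \<Rightarrow> (nat \<Rightarrow> 'a \<Rightarrow> 'b) \<Rightarrow> bool" where
  "L2_basis \<Omega> V n b \<longleftrightarrow>
     (\<forall>i<n. b i \<in> V) \<and>
     (\<forall>c :: nat \<Rightarrow> real. (AE x in lebesgue_on \<Omega>. (\<Sum>i<n. c i *\<^sub>R b i x) = 0) \<longrightarrow> (\<forall>i<n. c i = 0)) \<and>
     (\<forall>v\<in>V. \<exists>c :: nat \<Rightarrow> real. AE x in lebesgue_on \<Omega>. v x = (\<Sum>i<n. c i *\<^sub>R b i x))"

text \<open>Rows are indexed by the test functions (second argument of the form), columns by the trial
  functions (first argument).\<close>

definition form_mat ::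
    "('u \<Rightarrow> 'v \<Rightarrow> real) \<Rightarrow> nat \<Rightarrow> (nat \<Rightarrow> 'u) \<Rightarrow> nat \<Rightarrow> (nat \<Rightarrow> 'v) \<Rightarrow> real mat" where
  "form_mat a ntrial trial ntest test = mat ntest ntrial (\<lambda>(i, j). a (trial j) (test i))"

definition form_A :: "'a::euclidean_space set \<Rightarrow> ('a \<Rightarrow> 'a) \<Rightarrow> ('a \<Rightarrow> 'a) \<Rightarrow> real" where
  "form_A \<Omega> s t = L2_inner \<Omega> s t + L2_inner \<Omega> (weak_div \<Omega> s) (weak_div \<Omega> t)"

definition form_B :: "'a::euclidean_space set \<Rightarrow> ('a \<Rightarrow> 'a) \<Rightarrow> ('a \<Rightarrow> real) \<Rightarrow> real" where
  "form_B \<Omega> s q = - L2_inner \<Omega> s (weak_grad \<Omega> q)"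

definition form_C :: "'a::euclidean_space set \<Rightarrow> ('a \<Rightarrow> real) \<Rightarrow> ('a \<Rightarrow> real) \<Rightarrow> real" where
  "form_C \<Omega> p q = L2_inner \<Omega> (weak_grad \<Omega> p) (weak_grad \<Omega> q)"

definition gen_eigenspace :: "'k::field mat \<Rightarrow> 'k mat \<Rightarrow> 'k \<Rightarrow> 'k Matrix.vec set" where
  "gen_eigenspace K N \<mu> = {z \<in> carrier_vec (dim_col K). K *\<^sub>v z = \<mu> \<cdot>\<^sub>v (N *\<^sub>v z)}"

definition gen_eigenvalue :: "'k::field mat \<Rightarrow> 'k mat \<Rightarrow> 'k \<Rightarrow> bool" where
  "gen_eigenvalue K N \<mu> \<longleftrightarrow> (\<exists>z \<in> gen_eigenspace K N \<mu>. z \<noteq> 0\<^sub>v (dim_col K))"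

text \<open>For invertible \<open>K\<close>, the eigenspace of \<open>\<mu> = \<infinity>\<close> is by convention the kernel of \<open>N\<close>: it is the
  eigenspace of \<open>N z = \<nu> K z\<close> for \<open>\<nu> = 1 / \<mu> = 0\<close>.\<close>

definition gen_eigenspace_infinity :: "'k::field mat \<Rightarrow> 'k mat \<Rightarrow> 'k Matrix.vec set" where
  "gen_eigenspace_infinity K N = mat_kernel N"

definition vec_subspace_dim :: "nat \<Rightarrow> 'k::field Matrix.vec set \<Rightarrow> nat" where
  "vec_subspace_dim k E = vectorspace.dim class_ring (module_vec TYPE('k) k\<lparr>carrier := E\<rparr>)"

definition gen_multiplicity :: "'k::field mat \<Rightarrow> 'k mat \<Rightarrow> 'k \<Rightarrow> nat" where
  "gen_multiplicity K N \<mu> = vec_subspace_dim (dim_col K) (gen_eigenspace K N \<mu>)"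

definition gen_multiplicity_infinity :: "'k::field mat \<Rightarrow> 'k mat \<Rightarrow> nat" where
  "gen_multiplicity_infinity K N = vec_subspace_dim (dim_col K) (gen_eigenspace_infinity K N)"

end

theory Submission
  imports Defs
begin

text \<open>With \<open>s\<close> and \<open>p\<close> the functions with coefficient vectors \<open>x\<close> and \<open>y\<close>, the quadratic form of \<open>K\<close>
  is \<open>\<parallel>s - \<nabla>p\<parallel>\<^sup>2 + \<parallel>div s\<parallel>\<^sup>2\<close>. If it vanishes, then \<open>div s = 0\<close>, so integration by parts makes
  \<open>s\<close> and \<open>\<nabla>p\<close> orthogonal; hence \<open>s = \<nabla>p = 0\<close>, and \<open>p = 0\<close> because \<open>p\<close> is in \<open>H10\<close> of a bounded
  set. So \<open>K\<close> is symmetric positive definite, and \<open>N\<close> is symmetric positive semidefinite with a kernel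
  of dimension \<open>m\<close>. A \<open>K\<close>-orthonormal basis of vectors with \<open>N z = \<nu> K z\<close> then has \<open>m\<close> members
  with \<open>\<nu> = 0\<close>, and its \<open>n\<close> other members are eigenvectors for \<open>\<mu> = 1 / \<nu>\<close>.\<close>

text \<open>\<open>weak_div\<close> and \<open>weak_grad\<close> are arbitrary choices among
  functions agreeing almost everywhere, so they cannot be treated as linear operators, and the weak
  derivative of a combination is never formed by them. The divergence and gradient attached to a
  coefficient vector are the combinations of the chosen derivatives of the basis functions, which is
  exactly what the matrix entries see. Likewise only the basis functions are used as members of
  \<open>H10\<close>; a combination enters through the weak gradient it inherits.

  As \<open>N\<close> is singular, \<open>K\<close> has to serve as the inner product, and the
  reciprocal \<nu> is the parameter for which a full set of eigenvectors exists. Multiplicities are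
  dimensions of eigenspaces, so they add up to the size of the pencil only because it is
  diagonalizable; symmetry secures this by successive maximisation of the Rayleigh quotient.\<close>

unbundle no inner_syntax
unbundle no vec_syntax

section \<open>Symmetric definite matrix pencils\<close>

lemma scalar_prod_mult_mat_vec_expand:
  fixes N :: "'a::comm_ring_1 mat"
  assumes "N \<in> carrier_mat n m" "w \<in> carrier_vec n" "v \<in> carrier_vec m"
  shows "w \<bullet> (N *\<^sub>v v) = (\<Sum>i<n. \<Sum>j<m. w $ i * N $$ (i, j) * v $ j)"
  using assms
  by (auto simp: scalar_prod_def lessThan_atLeast0 sum_distrib_left mult.assoc intro!: sum.cong)

text \<open>The right side is summed entry by entry rather than written as \<open>a\<close> of two
  combinations, since the forms contain the choices \<open>weak_div\<close> and
  \<open>weak_grad\<close>. The nesting of the sums is that of \<open>L2_inner_lincomb\<close>, so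
  that the two match term by term.\<close>

lemma scalar_prod_form_mat:
  assumes "x \<in> carrier_vec m" "y \<in> carrier_vec n"
  shows "y \<bullet> (form_mat a m f n g *\<^sub>v x) = (\<Sum>i<n. y $ i * (\<Sum>j<m. x $ j * a (f j) (g i)))"
proof -
  have "form_mat a m f n g \<in> carrier_mat n m" by (simp add: form_mat_def)
  from scalar_prod_mult_mat_vec_expand[OF this assms(2,1)] show ?thesis
    by (simp add: form_mat_def sum_distrib_left mult_ac)
qed

lemma scalar_prod_lincomb:
  fixes u :: "'a::comm_ring_1 Matrix.vec"
  assumes "u \<in> carrier_vec d" "\<And>i. i \<in> I \<Longrightarrow> z i \<in> carrier_vec d"
  shows "u \<bullet> vec d (\<lambda>k. \<Sum>i\<in>I. c i * z i $ k) = (\<Sum>i\<in>I. c i * (u \<bullet> z i))"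
proof -
  have "u \<bullet> vec d (\<lambda>k. \<Sum>i\<in>I. c i * z i $ k) = (\<Sum>k<d. \<Sum>i\<in>I. c i * (u $ k * z i $ k))"
    by (auto simp: scalar_prod_def lessThan_atLeast0 sum_distrib_left mult.left_commute intro!: sum.cong)
  also have "\<dots> = (\<Sum>i\<in>I. \<Sum>k<d. c i * (u $ k * z i $ k))"
    by (rule sum.swap)
  also have "\<dots> = (\<Sum>i\<in>I. c i * (u \<bullet> z i))"
    using carrier_vecD[OF assms(2)]
    by (auto simp: scalar_prod_def lessThan_atLeast0 sum_distrib_left intro!: sum.cong)
  finally show ?thesis .
qed

lemma scalar_prod_symmetric_mat:
  fixes K :: "'a::comm_ring_1 mat"
  assumes "K \<in> carrier_mat d d" "transpose_mat K = K" "v \<in> carrier_vec d" "w \<in> carrier_vec d"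
  shows "(K *\<^sub>v v) \<bullet> w = v \<bullet> (K *\<^sub>v w)"
  using transpose_vec_mult_scalar[OF assms(1,4,3)] assms(2) by simp

text \<open>Duality makes the \<open>b i\<close> independent, because pairing a combination with
  \<open>f j\<close> reads off a coefficient; the expansion makes them span. The dual family of the
  unit vectors is themselves, that of \<open>K\<close>-orthonormal vectors \<open>z i\<close> is
  \<open>K *\<^sub>v z i\<close>.\<close>

lemma dim_mat_kernel_dual_basis:
  fixes A :: "'a::field mat"
  assumes A: "A \<in> carrier_mat nr nc" and I: "finite I"
    and b: "\<And>i. i \<in> I \<Longrightarrow> b i \<in> mat_kernel A"
    and f: "\<And>i. i \<in> I \<Longrightarrow> f i \<in> carrier_vec nc"
    and dual: "\<And>i j. i \<in> I \<Longrightarrow> j \<in> I \<Longrightarrow> f i \<bullet> b j = (if i = j then 1 else 0)"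
    and expand: "\<And>v k. v \<in> mat_kernel A \<Longrightarrow> k < nc \<Longrightarrow> v $ k = (\<Sum>i\<in>I. (f i \<bullet> v) * b i $ k)"
  shows "vec_subspace_dim nc (mat_kernel A) = card I"
proof -
  interpret kernel nr nc A by unfold_locales (rule A)
  \<comment> \<open>Bases are sets here, so \<open>card I\<close> is the right count only for an
    injective family.\<close>
  have inj: "inj_on b I"
    by (rule inj_onI) (metis dual zero_neq_one)
  have bc: "b ` I \<subseteq> carrier_vec nc"
    using b mat_kernel[OF A] by auto
  have lc: "NC.lincomb a (b ` I) $ k = (\<Sum>i\<in>I. a (b i) * b i $ k)" if "k < nc" for a k
    using NC.lincomb_index[OF that bc] by (simp add: sum.reindex[OF inj])
  have lcv: "NC.lincomb a (b ` I) = vec nc (\<lambda>k. \<Sum>i\<in>I. a (b i) * b i $ k)" for a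
    by (rule eq_vecI) (use lc NC.lincomb_dim[OF _ bc] I in auto)
  have "\<not> NC.lin_dep (b ` I)"
  proof
    assume "NC.lin_dep (b ` I)"
    then obtain a v where a: "NC.lincomb a (b ` I) = 0\<^sub>v nc" "v \<in> b ` I" "a v \<noteq> 0"
      using NC.finite_lin_dep[OF _ _ bc] I by auto
    then obtain j where j: "j \<in> I" "v = b j" by auto
    have "0 = f j \<bullet> NC.lincomb a (b ` I)"
      using a f[OF j(1)] by simp
    also have "\<dots> = (\<Sum>i\<in>I. a (b i) * (f j \<bullet> b i))"
      unfolding lcv by (rule scalar_prod_lincomb) (use f j bc in auto)
    also have "\<dots> = (\<Sum>i\<in>I. if j = i then a (b i) else 0)"
      by (rule sum.cong) (use dual j in auto)
    also have "\<dots> = a v" using I j by simp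
    finally show False using a by simp
  qed
  moreover have "NC.span (b ` I) = mat_kernel A"
  proof
    show "NC.span (b ` I) \<subseteq> mat_kernel A"
      using span_same[of "b ` I"] Ker.span_is_subset2[of "b ` I"] b by auto
    show "mat_kernel A \<subseteq> NC.span (b ` I)"
    proof
      fix v assume v: "v \<in> mat_kernel A"
      have "v = NC.lincomb (\<lambda>x. f (inv_into I b x) \<bullet> v) (b ` I)"
        unfolding lcv by (rule eq_vecI) (use v expand mat_kernelD[OF A v] inj in auto)
      then show "v \<in> NC.span (b ` I)"
        using NC.in_spanI[of v _ "b ` I" "b ` I"] I by blast
    qed
  qed
  \<comment> \<open>Independence and span were established in the ambient space; both transfer to
    the kernel because the family lies in it.\<close>
  ultimately have "Ker.basis (b ` I)"
    using b lindep_same[of "b ` I"] span_same[of "b ` I"] unfolding Ker.basis_def by auto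
  then have "Ker.dim = card (b ` I)"
    using Ker.dim_basis I by auto
  then show ?thesis
    using card_image[OF inj] by (simp add: vec_subspace_dim_def)
qed

section \<open>Eigenvectors from the Rayleigh quotient\<close>

lemma exists_nonzero_vec_orthogonal:
  fixes a :: "nat \<Rightarrow> 'a::field Matrix.vec"
  assumes "k < d" "\<And>i. i < k \<Longrightarrow> a i \<in> carrier_vec d"
  obtains w where "w \<in> carrier_vec d" "w \<noteq> 0\<^sub>v d" "\<And>i. i < k \<Longrightarrow> a i \<bullet> w = 0"
proof -
  \<comment> \<open>The conditions are padded with zero rows to a square matrix. Row
    \<open>k\<close> is zero, so the transpose kills \<open>unit_vec d k\<close> and the determinant
    vanishes.\<close>
  define G where "G = mat d d (\<lambda>(i, j). if i < k then a i $ j else 0)"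
  have G: "G \<in> carrier_mat d d" by (simp add: G_def)
  have "transpose_mat G *\<^sub>v unit_vec d k = 0\<^sub>v d"
    using \<open>k < d\<close> by (intro eq_vecI) (auto simp: G_def)
  moreover have "unit_vec d k \<noteq> (0\<^sub>v d :: 'a Matrix.vec)"
    using \<open>k < d\<close> by (metis index_unit_vec(1) index_zero_vec(1) zero_neq_one)
  ultimately have "det (transpose_mat G) = 0"
    using det_0_iff_vec_prod_zero[of "transpose_mat G" d] G unit_vec_carrier[of d k] transpose_carrier_mat
    by blast
  then have "det G = 0" using det_transpose[OF G] by simp
  then obtain w where w: "w \<in> carrier_vec d" "w \<noteq> 0\<^sub>v d" "G *\<^sub>v w = 0\<^sub>v d"
    using det_0_iff_vec_prod_zero[OF G] by blast
  have "a i \<bullet> w = 0" if "i < k" for i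
  proof -
    have "row G i = a i" using assms(2)[OF that] that \<open>k < d\<close> by (auto simp: G_def)
    then show ?thesis
      using w(3) that \<open>k < d\<close> G by (metis carrier_matD(1) index_mult_mat_vec index_zero_vec(1) less_trans)
  qed
  with w show ?thesis using that by blast
qed

text \<open>The quotient is constant along rays, so its maximum \<nu> on the unit sphere of the
  constrained subspace, which exists by compactness, bounds it on the whole subspace. The condition
  \<open>k < d\<close> keeps that sphere nonempty.\<close>

lemma rayleigh_quotient_attains_max:
  fixes K N :: "real mat" and a :: "nat \<Rightarrow> real Matrix.vec"
  assumes K: "K \<in> carrier_mat d d" and N: "N \<in> carrier_mat d d"
    and pos: "\<And>v. v \<in> carrier_vec d \<Longrightarrow> v \<noteq> 0\<^sub>v d \<Longrightarrow> v \<bullet> (K *\<^sub>v v) > 0"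
    and a: "\<And>i. i < k \<Longrightarrow> a i \<in> carrier_vec d" and k: "k < d"
  obtains w \<nu> where "w \<in> carrier_vec d" "w \<noteq> 0\<^sub>v d" "\<And>i. i < k \<Longrightarrow> a i \<bullet> w = 0"
    "w \<bullet> (N *\<^sub>v w) = \<nu> * (w \<bullet> (K *\<^sub>v w))"
    "\<And>v. v \<in> carrier_vec d \<Longrightarrow> (\<And>i. i < k \<Longrightarrow> a i \<bullet> v = 0) \<Longrightarrow> v \<bullet> (N *\<^sub>v v) \<le> \<nu> * (v \<bullet> (K *\<^sub>v v))"
proof -
  \<comment> \<open>Compactness is obtained in \<open>nat \<Rightarrow> real\<close> with the
    product topology: coordinates from \<open>d\<close> on are pinned to 0, and the others, at most
    1 in modulus on the unit sphere, range over a compact cube.\<close>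
  define B :: "(nat \<Rightarrow> real) set" where "B = PiE UNIV (\<lambda>i. if i < d then {-1..1} else {0})"
  define S where "S = {w \<in> B. (\<Sum>i<d. (w i)\<^sup>2) = 1 \<and> (\<forall>i\<in>{..<k}. (\<Sum>j<d. a i $ j * w j) = 0)}"
  define Q where "Q H w = (\<Sum>i<d. \<Sum>j<d. w i * H $$ (i, j) * w j)" for H :: "real mat" and w :: "nat \<Rightarrow> real"
  have "compactin (product_topology (\<lambda>i. euclidean) UNIV) B"
    unfolding B_def compactin_PiE by auto
  then have "compact B"
    by (simp add: euclidean_product_topology)
  have coord: "continuous_on X (\<lambda>w. w i)" for X :: "(nat \<Rightarrow> real) set" and i
    by (rule continuous_on_subset[OF continuous_on_product_coordinates]) auto
  have S_eq: "S = B \<inter> ({w. (\<Sum>i<d. (w i)\<^sup>2) = 1} \<inter> (\<Inter>i\<in>{..<k}. {w. (\<Sum>j<d. a i $ j * w j) = 0}))"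
    unfolding S_def by auto
  have "closed ({w::nat \<Rightarrow> real. (\<Sum>i<d. (w i)\<^sup>2) = 1} \<inter> (\<Inter>i\<in>{..<k}. {w. (\<Sum>j<d. a i $ j * w j) = 0}))"
    by (intro closed_Int closed_INT ballI closed_Collect_eq continuous_intros coord)
  then have "compact S"
    unfolding S_eq using \<open>compact B\<close> by (intro compact_Int_closed)
  have Qvec: "v \<bullet> (H *\<^sub>v v) = Q H (\<lambda>i. v $ i)" if "v \<in> carrier_vec d" "H \<in> carrier_mat d d" for v H
    using scalar_prod_mult_mat_vec_expand[OF that(2,1,1)] by (simp add: Q_def)
  have Qscale: "Q H (\<lambda>i. c * w i) = c\<^sup>2 * Q H w" for H c w
    by (simp add: Q_def sum_distrib_left power2_eq_square mult_ac)
  have Qcong: "Q H w = Q H w'" if "\<And>i. i < d \<Longrightarrow> w i = w' i" for H w w'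
    using that by (simp add: Q_def)
  have vecS: "vec d w \<in> carrier_vec d" "vec d w \<noteq> 0\<^sub>v d" "\<And>i. i < k \<Longrightarrow> a i \<bullet> vec d w = 0"
    "\<And>H. H \<in> carrier_mat d d \<Longrightarrow> vec d w \<bullet> (H *\<^sub>v vec d w) = Q H w" if w: "w \<in> S" for w
  proof -
    show "vec d w \<in> carrier_vec d" by simp
    show "vec d w \<noteq> 0\<^sub>v d"
    proof
      assume *: "vec d w = 0\<^sub>v d"
      have "w i = 0" if "i < d" for i
        using arg_cong[OF *, of "\<lambda>v. v $ i"] that by simp
      then have "(\<Sum>i<d. (w i)\<^sup>2) = 0" by simp
      with w show False by (simp add: S_def)
    qed
    show "a i \<bullet> vec d w = 0" if "i < k" for i
      using w that by (simp add: S_def scalar_prod_def lessThan_atLeast0)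
    show "vec d w \<bullet> (H *\<^sub>v vec d w) = Q H w" if "H \<in> carrier_mat d d" for H
      by (subst Qvec) (auto simp: that intro: Qcong)
  qed
  have Kpos: "Q K w > 0" if "w \<in> S" for w
    using vecS[OF that] pos K by metis
  have contF: "continuous_on S (\<lambda>w. Q N w / Q K w)"
    using Kpos unfolding Q_def by (intro continuous_intros coord) force
  have normalise: "\<exists>w\<in>S. \<exists>c>0. \<forall>i<d. v $ i = c * w i"
    if v: "v \<in> carrier_vec d" "v \<noteq> 0\<^sub>v d" "\<And>i. i < k \<Longrightarrow> a i \<bullet> v = 0" for v
  proof -
    define c where "c = sqrt (\<Sum>i<d. (v $ i)\<^sup>2)"
    have "\<exists>i<d. v $ i \<noteq> 0"
      using v(1,2) by (metis carrier_vecD eq_vecI index_zero_vec)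
    then have "(\<Sum>i<d. (v $ i)\<^sup>2) > 0"
      by (force intro: sum_pos2)
    then have c: "c > 0" "c\<^sup>2 = (\<Sum>i<d. (v $ i)\<^sup>2)"
      by (auto simp: c_def)
    define w where "w i = (if i < d then v $ i / c else 0)" for i
    have s1: "(\<Sum>i<d. (w i)\<^sup>2) = 1"
      using c(1) by (simp add: w_def power_divide c(2)[symmetric] flip: sum_divide_distrib)
    have "w i \<in> {-1..1}" if "i < d" for i
    proof -
      have "(w i)\<^sup>2 \<le> (\<Sum>i<d. (w i)\<^sup>2)"
        by (rule member_le_sum) (use that in auto)
      then show ?thesis using s1 by (auto simp: abs_square_le_1 abs_le_iff)
    qed
    then have "w \<in> B" by (auto simp: B_def PiE_iff) (simp add: w_def)
    moreover have "(\<Sum>j<d. a i $ j * w j) = 0" if "i < k" for i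
      using v(3)[OF that] v(1) 
      by (simp add: w_def scalar_prod_def lessThan_atLeast0 flip: sum_divide_distrib)
    ultimately have "w \<in> S" using s1 by (simp add: S_def)
    then show ?thesis using c(1) by (intro bexI[of _ w] exI[of _ c]) (auto simp: w_def)
  qed
  obtain v0 where "v0 \<in> carrier_vec d" "v0 \<noteq> 0\<^sub>v d" "\<And>i. i < k \<Longrightarrow> a i \<bullet> v0 = 0"
    using exists_nonzero_vec_orthogonal[of k d a, OF k a] by blast
  then have "S \<noteq> {}" using normalise by blast
  then obtain w where w: "w \<in> S" "\<And>w'. w' \<in> S \<Longrightarrow> Q N w' / Q K w' \<le> Q N w / Q K w"
    using continuous_attains_sup[OF \<open>compact S\<close> _ contF] by blast
  define \<nu> where "\<nu> = Q N w / Q K w"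
  show thesis
  proof (rule that[of "vec d w" \<nu>])
    show "vec d w \<bullet> (N *\<^sub>v vec d w) = \<nu> * (vec d w \<bullet> (K *\<^sub>v vec d w))"
      using vecS(4)[OF w(1)] K N Kpos[OF w(1)] by (simp add: \<nu>_def)
    fix v assume v: "v \<in> carrier_vec d" "\<And>i. i < k \<Longrightarrow> a i \<bullet> v = 0"
    show "v \<bullet> (N *\<^sub>v v) \<le> \<nu> * (v \<bullet> (K *\<^sub>v v))"
    proof (cases "v = 0\<^sub>v d")
      case True
      then show ?thesis using K N by simp
    next
      case False
      from normalise[OF v(1) False v(2)] obtain w' c
        where w': "w' \<in> S" "c > 0" "\<forall>i<d. v $ i = c * w' i" by auto
      have q: "v \<bullet> (H *\<^sub>v v) = c\<^sup>2 * Q H w'" if "H \<in> carrier_mat d d" for H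
        using Qvec[OF v(1) that] Qcong[of "\<lambda>i. v $ i" "\<lambda>i. c * w' i" H] w'(3) Qscale by simp
      have "Q N w' \<le> \<nu> * Q K w'"
        using w(2)[OF w'(1)] Kpos[OF w'(1)] by (simp add: \<nu>_def pos_divide_le_eq)
      then have "c\<^sup>2 * Q N w' \<le> c\<^sup>2 * (\<nu> * Q K w')"
        by (rule mult_left_mono) simp
      then show ?thesis using q K N by (simp add: mult_ac)
    qed
  qed (use vecS[OF w(1)] in auto)
qed

text \<open>For small \<open>t\<close> of sign opposite to \<open>a\<close> the linear term would
  outweigh the quadratic one.\<close>

lemma linear_plus_quadratic_nonneg_imp_zero:
  fixes a b :: real
  assumes "\<And>t. 2 * t * a + t\<^sup>2 * b \<ge> 0"
  shows "a = 0"
proof (rule ccontr)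
  assume "a \<noteq> 0"
  \<comment> \<open>Any positive \<open>s\<close> with \<open>s * b < 2\<close> would do: at
    \<open>t = - s * a\<close> the expression equals
    \<open>s * a\<^sup>2 * (s * b - 2)\<close>.\<close>
  define s where "s = 1 / (\<bar>b\<bar> + 1)"
  have s: "s > 0" "s * \<bar>b\<bar> < 1" by (auto simp: s_def)
  have "0 \<le> 2 * (- s * a) * a + (- s * a)\<^sup>2 * b" by (rule assms)
  also have "\<dots> = s * a\<^sup>2 * (s * b - 2)" by (simp add: power2_eq_square algebra_simps)
  finally have "0 \<le> s * a\<^sup>2 * (s * b - 2)" .
  moreover have "s * a\<^sup>2 > 0" using s(1) \<open>a \<noteq> 0\<close> by simp
  ultimately have "s * b - 2 \<ge> 0"
    using mult_pos_neg[of "s * a\<^sup>2" "s * b - 2"] by linarith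
  moreover have "s * b \<le> s * \<bar>b\<bar>" using s(1) by (intro mult_left_mono) auto
  ultimately show False using s(2) by linarith
qed

lemma smult_mat_mult_vec:
  fixes A :: "'a::comm_ring_1 mat"
  assumes "A \<in> carrier_mat nr nc" "v \<in> carrier_vec nc"
  shows "(c \<cdot>\<^sub>m A) *\<^sub>v v = c \<cdot>\<^sub>v (A *\<^sub>v v)"
  using assms by (intro eq_vecI) (auto simp: scalar_prod_def sum_distrib_left mult.assoc)

text \<open>The new eigenvector \<open>w\<close> maximises the Rayleigh quotient on the \<open>K\<close>-orthogonal complement of the
  given ones. There \<open>\<kappa> K - N\<close> is positive semidefinite and vanishes at \<open>w\<close>, so the residual
  \<open>(\<kappa> K - N) w\<close> is orthogonal to that complement, and also to the given eigenvectors.\<close>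

lemma pencil_extend_eigenvectors:
  fixes K N :: "real mat" and z :: "nat \<Rightarrow> real Matrix.vec"
  assumes K: "K \<in> carrier_mat d d" "transpose_mat K = K"
    and N: "N \<in> carrier_mat d d" "transpose_mat N = N"
    and pos: "\<And>v. v \<in> carrier_vec d \<Longrightarrow> v \<noteq> 0\<^sub>v d \<Longrightarrow> v \<bullet> (K *\<^sub>v v) > 0"
    and z: "\<And>i. i < k \<Longrightarrow> z i \<in> carrier_vec d"
    and eig: "\<And>i. i < k \<Longrightarrow> N *\<^sub>v z i = \<nu> i \<cdot>\<^sub>v (K *\<^sub>v z i)"
    and orth: "\<And>i j. i < k \<Longrightarrow> j < k \<Longrightarrow> z i \<bullet> (K *\<^sub>v z j) = (if i = j then 1 else 0)"
    and k: "k < d"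
  obtains w \<kappa> where "w \<in> carrier_vec d" "N *\<^sub>v w = \<kappa> \<cdot>\<^sub>v (K *\<^sub>v w)" "w \<bullet> (K *\<^sub>v w) = 1"
    "\<And>i. i < k \<Longrightarrow> z i \<bullet> (K *\<^sub>v w) = 0"
proof -
  have symK: "v \<bullet> (K *\<^sub>v w) = w \<bullet> (K *\<^sub>v v)" if "v \<in> carrier_vec d" "w \<in> carrier_vec d" for v w
    using scalar_prod_symmetric_mat[OF K that] comm_scalar_prod[of "K *\<^sub>v v" d w] that K(1) by simp
  have Kz: "K *\<^sub>v z i \<in> carrier_vec d" if "i < k" for i
    using K z[OF that] by simp
  have Kz_prod: "(K *\<^sub>v z i) \<bullet> v = z i \<bullet> (K *\<^sub>v v)" if "i < k" "v \<in> carrier_vec d" for i v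
    using scalar_prod_symmetric_mat[OF K z that(2)] that by simp
  obtain w \<kappa> where w: "w \<in> carrier_vec d" "w \<noteq> 0\<^sub>v d" "\<And>i. i < k \<Longrightarrow> (K *\<^sub>v z i) \<bullet> w = 0"
    and max: "w \<bullet> (N *\<^sub>v w) = \<kappa> * (w \<bullet> (K *\<^sub>v w))"
      "\<And>v. v \<in> carrier_vec d \<Longrightarrow> (\<And>i. i < k \<Longrightarrow> (K *\<^sub>v z i) \<bullet> v = 0) \<Longrightarrow>
        v \<bullet> (N *\<^sub>v v) \<le> \<kappa> * (v \<bullet> (K *\<^sub>v v))"
    by (rule rayleigh_quotient_attains_max[where a = "\<lambda>i. K *\<^sub>v z i", OF K(1) N(1) pos Kz k]) blast+
  define S where "S = \<kappa> \<cdot>\<^sub>m K - N"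
  have S: "S \<in> carrier_mat d d" unfolding S_def by (rule minus_carrier_mat[OF N(1)])
  have Sv: "S *\<^sub>v v = \<kappa> \<cdot>\<^sub>v (K *\<^sub>v v) - N *\<^sub>v v" if "v \<in> carrier_vec d" for v
    using K N that by (auto simp: S_def minus_mult_distrib_mat_vec[of _ d d] smult_mat_mult_vec[of _ d d])
  have S_prod: "u \<bullet> (S *\<^sub>v v) = \<kappa> * (u \<bullet> (K *\<^sub>v v)) - u \<bullet> (N *\<^sub>v v)"
    if "u \<in> carrier_vec d" "v \<in> carrier_vec d" for u v
    using K N that by (simp add: Sv scalar_prod_minus_distrib[of _ d])
  have symS: "v \<bullet> (S *\<^sub>v u) = u \<bullet> (S *\<^sub>v v)" if "v \<in> carrier_vec d" "u \<in> carrier_vec d" for v u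
    using scalar_prod_symmetric_mat[OF N that] comm_scalar_prod[of "N *\<^sub>v v" d u] that N(1)
    by (simp add: S_prod symK[OF that])
  have ortho: "v \<bullet> (S *\<^sub>v w) = 0"
    if v: "v \<in> carrier_vec d" "\<And>i. i < k \<Longrightarrow> (K *\<^sub>v z i) \<bullet> v = 0" for v
  \<comment> \<open>First variation at \<open>w\<close> along \<open>v\<close>: the constant term is
    zero because the form of \<open>S\<close> vanishes at \<open>w\<close>, and the symmetry of
    \<open>S\<close> merges the two linear terms.\<close>
  proof (rule linear_plus_quadratic_nonneg_imp_zero)
    fix t
    let ?x = "w + t \<cdot>\<^sub>v v"
    have x: "?x \<in> carrier_vec d" using v w by simp
    have "(K *\<^sub>v z i) \<bullet> ?x = 0" if "i < k" for i
      using that v w Kz[OF that] by (simp add: scalar_prod_add_distrib[of _ d])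
    from max(2)[OF x this] have "0 \<le> ?x \<bullet> (S *\<^sub>v ?x)"
      using S_prod[OF x x] by simp
    also have "\<dots> = w \<bullet> (S *\<^sub>v w) + t * (w \<bullet> (S *\<^sub>v v)) + (t * (v \<bullet> (S *\<^sub>v w)) + t * (t * (v \<bullet> (S *\<^sub>v v))))"
      using S v w by (simp add: mult_add_distrib_mat_vec[of _ d d] mult_mat_vec[of _ d d]
          scalar_prod_add_distrib[of _ d] add_scalar_prod_distrib[of _ d] algebra_simps)
    also have "w \<bullet> (S *\<^sub>v w) = 0"
      using S_prod[OF w(1) w(1)] max(1) by simp
    finally show "2 * t * (v \<bullet> (S *\<^sub>v w)) + t\<^sup>2 * (v \<bullet> (S *\<^sub>v v)) \<ge> 0"
      using symS[OF v(1) w(1)] by (simp add: power2_eq_square mult_ac)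
  qed
  have orthz: "z i \<bullet> (S *\<^sub>v w) = 0" if "i < k" for i
  proof -
    have "z i \<bullet> (N *\<^sub>v w) = (N *\<^sub>v z i) \<bullet> w"
      using scalar_prod_symmetric_mat[OF N z[OF that] w(1)] by simp
    also have "\<dots> = 0"
      using eig[OF that] w(3)[OF that] Kz[OF that] w(1) by simp
    finally show ?thesis
      using S_prod[OF z[OF that] w(1)] w(3)[OF that] Kz_prod[OF that w(1)] by simp
  qed
  have "v \<bullet> (S *\<^sub>v w) = 0" if v: "v \<in> carrier_vec d" for v
  proof -
    \<comment> \<open>\<open>p\<close> is the \<open>K\<close>-orthogonal projection of
      \<open>v\<close> onto the span of the given eigenvectors; \<open>v - p\<close> is handled by
      \<open>ortho\<close> and \<open>p\<close> by \<open>orthz\<close>.\<close>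
    define p where "p = vec d (\<lambda>l. \<Sum>i\<in>{..<k}. ((K *\<^sub>v z i) \<bullet> v) * z i $ l)"
    have p: "p \<in> carrier_vec d" by (simp add: p_def)
    have prod_p: "u \<bullet> p = (\<Sum>i\<in>{..<k}. ((K *\<^sub>v z i) \<bullet> v) * (u \<bullet> z i))" if "u \<in> carrier_vec d" for u
      unfolding p_def by (rule scalar_prod_lincomb) (use that z in auto)
    have "(K *\<^sub>v z i) \<bullet> (v - p) = 0" if i: "i < k" for i
    proof -
      have "(K *\<^sub>v z i) \<bullet> p = (\<Sum>j\<in>{..<k}. if i = j then (K *\<^sub>v z j) \<bullet> v else 0)"
        unfolding prod_p[OF Kz[OF i]]
        by (rule sum.cong) (use Kz_prod orth z i in auto)
      then show ?thesis
        using i v p Kz[OF i] by (simp add: scalar_prod_minus_distrib[of _ d])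
    qed
    then have "(v - p) \<bullet> (S *\<^sub>v w) = 0" using v p by (intro ortho) auto
    moreover have "(S *\<^sub>v w) \<bullet> p = 0"
      using S w orthz z by (subst prod_p) (auto simp: comm_scalar_prod[of "S *\<^sub>v w" d] intro!: sum.neutral)
    ultimately show ?thesis
      using v p S w by (simp add: minus_scalar_prod_distrib[of _ d] comm_scalar_prod[of "S *\<^sub>v w" d])
  qed
  then have "(S *\<^sub>v w) $ i = 0" if "i < d" for i
    using S w that scalar_prod_left_unit[of "S *\<^sub>v w" d i] by simp
  then have eigw: "N *\<^sub>v w = \<kappa> \<cdot>\<^sub>v (K *\<^sub>v w)"
    using K N S w by (intro eq_vecI) (auto simp: Sv)
  define c where "c = sqrt (w \<bullet> (K *\<^sub>v w))"
  have c: "c > 0" "c * c = w \<bullet> (K *\<^sub>v w)" using pos[OF w(1,2)] by (auto simp: c_def)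
  show thesis
  proof (rule that[of "(1 / c) \<cdot>\<^sub>v w" \<kappa>])
    show "(1 / c) \<cdot>\<^sub>v w \<in> carrier_vec d" using w by simp
    show "N *\<^sub>v ((1 / c) \<cdot>\<^sub>v w) = \<kappa> \<cdot>\<^sub>v (K *\<^sub>v ((1 / c) \<cdot>\<^sub>v w))"
      using w K N eigw by (simp add: mult_mat_vec[of _ d d] smult_smult_assoc mult.commute)
    show "((1 / c) \<cdot>\<^sub>v w) \<bullet> (K *\<^sub>v ((1 / c) \<cdot>\<^sub>v w)) = 1"
      using w K c by (simp add: mult_mat_vec[of _ d d] flip: c(2))
    fix i assume i: "i < k"
    show "z i \<bullet> (K *\<^sub>v ((1 / c) \<cdot>\<^sub>v w)) = 0"
      using w K z[OF i] w(3)[OF i] Kz_prod[OF i w(1)] by (simp add: mult_mat_vec[of _ d d])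
  qed
qed

lemma pencil_orthonormal_eigenvectors:
  fixes K N :: "real mat"
  assumes K: "K \<in> carrier_mat d d" "transpose_mat K = K"
    and N: "N \<in> carrier_mat d d" "transpose_mat N = N"
    and pos: "\<And>v. v \<in> carrier_vec d \<Longrightarrow> v \<noteq> 0\<^sub>v d \<Longrightarrow> v \<bullet> (K *\<^sub>v v) > 0"
    and "k \<le> d"
  shows "\<exists>z \<nu>. (\<forall>i<k. z i \<in> carrier_vec d \<and> N *\<^sub>v z i = \<nu> i \<cdot>\<^sub>v (K *\<^sub>v z i)) \<and>
    (\<forall>i<k. \<forall>j<k. z i \<bullet> (K *\<^sub>v z j) = (if i = j then 1 else 0))"
  using \<open>k \<le> d\<close>
proof (induction k)
  case 0
  then show ?case by simp
next
  case (Suc k)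
  then obtain z \<nu> where z: "\<And>i. i < k \<Longrightarrow> z i \<in> carrier_vec d"
    and eig: "\<And>i. i < k \<Longrightarrow> N *\<^sub>v z i = \<nu> i \<cdot>\<^sub>v (K *\<^sub>v z i)"
    and orth: "\<And>i j. i < k \<Longrightarrow> j < k \<Longrightarrow> z i \<bullet> (K *\<^sub>v z j) = (if i = j then 1 else 0)"
    by (metis Suc_leD)
  have "k < d" using Suc.prems by simp
  obtain w \<kappa> where w: "w \<in> carrier_vec d" "N *\<^sub>v w = \<kappa> \<cdot>\<^sub>v (K *\<^sub>v w)" "w \<bullet> (K *\<^sub>v w) = 1"
    and zw: "\<And>i. i < k \<Longrightarrow> z i \<bullet> (K *\<^sub>v w) = 0"
    using pencil_extend_eigenvectors[OF K N pos z eig orth \<open>k < d\<close>] by blast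
  have wz: "w \<bullet> (K *\<^sub>v z i) = 0" if "i < k" for i
    using zw[OF that] scalar_prod_symmetric_mat[OF K z[OF that] w(1)] 
      comm_scalar_prod[of "K *\<^sub>v z i" d w] z[OF that] w(1) K(1) by simp
  show ?case
    by (rule exI[of _ "z(k := w)"], rule exI[of _ "\<nu>(k := \<kappa>)"])
      (use z eig orth w zw wz in \<open>auto simp: less_Suc_eq\<close>)
qed

text \<open>With the eigenvectors as columns of \<open>Z\<close>, orthonormality says that
  \<open>transpose_mat Z * K\<close> is a left inverse of \<open>Z\<close>. For square matrices it
  is also a right inverse, and that is the expansion of every vector.\<close>

lemma pencil_orthonormal_eigenbasis:
  fixes K N :: "real mat"
  assumes K: "K \<in> carrier_mat d d" "transpose_mat K = K"
    and N: "N \<in> carrier_mat d d" "transpose_mat N = N"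
    and pos: "\<And>v. v \<in> carrier_vec d \<Longrightarrow> v \<noteq> 0\<^sub>v d \<Longrightarrow> v \<bullet> (K *\<^sub>v v) > 0"
  obtains z \<nu> where "\<And>i. i < d \<Longrightarrow> z i \<in> carrier_vec d"
    "\<And>i. i < d \<Longrightarrow> N *\<^sub>v z i = \<nu> i \<cdot>\<^sub>v (K *\<^sub>v z i)"
    "\<And>i j. i < d \<Longrightarrow> j < d \<Longrightarrow> z i \<bullet> (K *\<^sub>v z j) = (if i = j then 1 else 0)"
    "\<And>v. v \<in> carrier_vec d \<Longrightarrow> v = vec d (\<lambda>k. \<Sum>i<d. (z i \<bullet> (K *\<^sub>v v)) * z i $ k)"
proof -
  obtain z \<nu> where z: "\<And>i. i < d \<Longrightarrow> z i \<in> carrier_vec d"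
    and eig: "\<And>i. i < d \<Longrightarrow> N *\<^sub>v z i = \<nu> i \<cdot>\<^sub>v (K *\<^sub>v z i)"
    and orth: "\<And>i j. i < d \<Longrightarrow> j < d \<Longrightarrow> z i \<bullet> (K *\<^sub>v z j) = (if i = j then 1 else 0)"
    using pencil_orthonormal_eigenvectors[OF K N pos order_refl] by metis
  define Z where "Z = mat d d (\<lambda>(k, i). z i $ k)"
  have Z: "Z \<in> carrier_mat d d" by (simp add: Z_def)
  have colZ: "col Z i = z i" if "i < d" for i
    using that z[OF that] by (auto simp: Z_def)
  have ZK: "transpose_mat Z * K \<in> carrier_mat d d" using Z K by simp
  have "z i \<bullet> vec d (\<lambda>l. row K l \<bullet> z j) = (if i = j then 1 else 0)" if "i < d" "j < d" for i j
    using orth[OF that] K by (simp add: mult_mat_vec_def)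
  then have "transpose_mat Z * (K * Z) = 1\<^sub>m d"
    using Z K by (intro eq_matI) (auto simp: colZ)
  then have "(transpose_mat Z * K) * Z = 1\<^sub>m d"
    using Z K by (simp add: assoc_mult_mat[of _ d d _ d _ d])
  then have inv: "Z * (transpose_mat Z * K) = 1\<^sub>m d"
    by (rule mat_mult_left_right_inverse[OF ZK Z])
  have "v = vec d (\<lambda>k. \<Sum>i<d. (z i \<bullet> (K *\<^sub>v v)) * z i $ k)" if v: "v \<in> carrier_vec d" for v
  proof -
    have "v = Z *\<^sub>v (transpose_mat Z *\<^sub>v (K *\<^sub>v v))"
      using inv v Z K assoc_mult_mat_vec[OF Z ZK v] by (simp add: assoc_mult_mat_vec[of _ d d _ d])
    also have "\<dots> = vec d (\<lambda>k. \<Sum>i<d. (z i \<bullet> (K *\<^sub>v v)) * z i $ k)"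
      using Z K v by (intro eq_vecI)
        (auto simp: scalar_prod_def[of "row Z _"] colZ lessThan_atLeast0 mult.commute Z_def[THEN arg_cong, of "\<lambda>M. M $$ _"] intro!: sum.cong)
    finally show ?thesis .
  qed
  with z eig orth show thesis by (rule that)
qed

section \<open>Counting eigenvalues with multiplicity\<close>

lemma gen_eigenspace_eq_mat_kernel:
  fixes K N :: "'a::field mat"
  assumes K: "K \<in> carrier_mat d d" and N: "N \<in> carrier_mat d d"
  shows "gen_eigenspace K N \<mu> = mat_kernel (K - \<mu> \<cdot>\<^sub>m N)"
proof -
  have A: "K - \<mu> \<cdot>\<^sub>m N \<in> carrier_mat d d"
    using N by (intro minus_carrier_mat) simp
  have "K *\<^sub>v v = \<mu> \<cdot>\<^sub>v (N *\<^sub>v v) \<longleftrightarrow> (K - \<mu> \<cdot>\<^sub>m N) *\<^sub>v v = 0\<^sub>v d" if v: "v \<in> carrier_vec d" for v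
  proof -
    have Nv: "N *\<^sub>v v \<in> carrier_vec d" and Kv: "K *\<^sub>v v \<in> carrier_vec d" using K N v by auto
    have "(K - \<mu> \<cdot>\<^sub>m N) *\<^sub>v v = K *\<^sub>v v - \<mu> \<cdot>\<^sub>v (N *\<^sub>v v)"
      using K N v by (simp add: minus_mult_distrib_mat_vec[of _ d d] smult_mat_mult_vec[of _ d d])
    moreover have "a = b \<longleftrightarrow> a - b = 0\<^sub>v d" if "a \<in> carrier_vec d" "b \<in> carrier_vec d" for a b :: "'a Matrix.vec"
      using that by (simp add: vec_eq_iff)
    ultimately show ?thesis using Kv Nv by (metis smult_carrier_vec)
  qed
  then show ?thesis
    using K unfolding mat_kernel[OF A] gen_eigenspace_def by auto
qed

text \<open>In the coordinates \<open>z i \<bullet> (K *\<^sub>v v)\<close> the matrix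
  \<open>K\<close> acts as the identity and \<open>N\<close> as the diagonal matrix of the
  \<open>\<nu> i\<close>. Each index then belongs to exactly one eigenspace: that of infinity if
  \<open>\<nu> i = 0\<close>, that of \<open>1 / \<nu> i\<close> otherwise.\<close>

lemma definite_pencil_spectrum:
  fixes K N :: "real mat"
  assumes K: "K \<in> carrier_mat d d" "transpose_mat K = K"
    and N: "N \<in> carrier_mat d d" "transpose_mat N = N"
    and pos: "\<And>v. v \<in> carrier_vec d \<Longrightarrow> v \<noteq> 0\<^sub>v d \<Longrightarrow> v \<bullet> (K *\<^sub>v v) > 0"
    and nonneg: "\<And>v. v \<in> carrier_vec d \<Longrightarrow> v \<bullet> (N *\<^sub>v v) \<ge> 0"
  shows "invertible_mat K" "finite {\<mu>. gen_eigenvalue K N \<mu>}"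
    "gen_eigenvalue K N \<mu> \<Longrightarrow> \<mu> > 0"
    "(\<Sum>\<mu> | gen_eigenvalue K N \<mu>. gen_multiplicity K N \<mu>) + gen_multiplicity_infinity K N = d"
proof -
  have "det K \<noteq> 0"
  proof
    assume "det K = 0"
    then obtain v where "v \<in> carrier_vec d" "v \<noteq> 0\<^sub>v d" "K *\<^sub>v v = 0\<^sub>v d"
      using det_0_iff_vec_prod_zero[OF K(1)] by blast
    with pos[of v] show False by simp
  qed
  from det_non_zero_imp_unit[OF K(1) this, of "()"]
  obtain L where "L \<in> carrier_mat d d" "L * K = 1\<^sub>m d" "K * L = 1\<^sub>m d"
    by (auto simp: Units_def ring_mat_def)
  then show "invertible_mat K"
    unfolding invertible_mat_def inverts_mat_def square_mat.simps using K(1) by auto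
next
  assume "gen_eigenvalue K N \<mu>"
  then obtain v where v: "v \<in> carrier_vec d" "v \<noteq> 0\<^sub>v d" "K *\<^sub>v v = \<mu> \<cdot>\<^sub>v (N *\<^sub>v v)"
    using K by (auto simp: gen_eigenvalue_def gen_eigenspace_def)
  \<comment> \<open>The sign of \<mu> is read off the two quadratic forms: the left side is positive
    and the factor of \<mu> is nonnegative.\<close>
  have "v \<bullet> (K *\<^sub>v v) = \<mu> * (v \<bullet> (N *\<^sub>v v))"
    using v(1) N by (simp add: v(3))
  then show "\<mu> > 0"
    using pos[OF v(1,2)] nonneg[OF v(1)] by (simp add: zero_less_mult_iff)
next
  have A: "K - \<mu> \<cdot>\<^sub>m N \<in> carrier_mat d d" for \<mu>
    using N by (intro minus_carrier_mat) simp
  obtain z \<nu> where z: "\<And>i. i < d \<Longrightarrow> z i \<in> carrier_vec d"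
    and eig: "\<And>i. i < d \<Longrightarrow> N *\<^sub>v z i = \<nu> i \<cdot>\<^sub>v (K *\<^sub>v z i)"
    and orth: "\<And>i j. i < d \<Longrightarrow> j < d \<Longrightarrow> z i \<bullet> (K *\<^sub>v z j) = (if i = j then 1 else 0)"
    and expand: "\<And>v. v \<in> carrier_vec d \<Longrightarrow> v = vec d (\<lambda>k. \<Sum>i<d. (z i \<bullet> (K *\<^sub>v v)) * z i $ k)"
    using pencil_orthonormal_eigenbasis[OF K N pos] by blast
  have Kz: "K *\<^sub>v z i \<in> carrier_vec d" if "i < d" for i
    using K z[OF that] by simp
  have Kz_prod: "(K *\<^sub>v z i) \<bullet> v = z i \<bullet> (K *\<^sub>v v)" if "i < d" "v \<in> carrier_vec d" for i v
    using scalar_prod_symmetric_mat[OF K z that(2)] that by simp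
  have Nz_prod: "z i \<bullet> (N *\<^sub>v v) = \<nu> i * (z i \<bullet> (K *\<^sub>v v))" if "i < d" "v \<in> carrier_vec d" for i v
  proof -
    have "z i \<bullet> (N *\<^sub>v v) = (N *\<^sub>v z i) \<bullet> v"
      using scalar_prod_symmetric_mat[OF N z[OF that(1)] that(2)] by simp
    then show ?thesis using eig[OF that(1)] Kz[OF that(1)] Kz_prod[OF that] that(2) by simp
  qed
  \<comment> \<open>One count serves both kinds of eigenspace: if the \<open>z i\<close> selected by
    \<open>P\<close> lie in the kernel and kernel vectors have no component along the others, the
    selected ones form a basis. \<open>P i\<close> becomes \<open>\<nu> i = 0\<close> for infinity
    and \<open>\<mu> * \<nu> i = 1\<close> for a finite eigenvalue.\<close>
  have dim: "vec_subspace_dim d (mat_kernel H) = card {i\<in>{..<d}. P i}"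
    if H: "H \<in> carrier_mat d d" and mem: "\<And>i. i < d \<Longrightarrow> P i \<Longrightarrow> z i \<in> mat_kernel H"
      and coeff: "\<And>v i. v \<in> mat_kernel H \<Longrightarrow> i < d \<Longrightarrow> \<not> P i \<Longrightarrow> z i \<bullet> (K *\<^sub>v v) = 0"
    for H and P :: "nat \<Rightarrow> bool"
  proof (rule dim_mat_kernel_dual_basis[where b = z and f = "\<lambda>i. K *\<^sub>v z i", OF H])
    fix v k assume v: "v \<in> mat_kernel H" and k: "k < d"
    then have vc: "v \<in> carrier_vec d" using mat_kernelD[OF H] by blast
    have "v $ k = (\<Sum>i<d. (z i \<bullet> (K *\<^sub>v v)) * z i $ k)"
      using arg_cong[OF expand[OF vc], of "\<lambda>x. x $ k"] k by simp
    also have "\<dots> = (\<Sum>i\<in>{i\<in>{..<d}. P i}. (z i \<bullet> (K *\<^sub>v v)) * z i $ k)"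
      by (rule sum.mono_neutral_right) (use coeff[OF v] in auto)
    also have "\<dots> = (\<Sum>i\<in>{i\<in>{..<d}. P i}. ((K *\<^sub>v z i) \<bullet> v) * z i $ k)"
      by (rule sum.cong) (auto simp: Kz_prod vc)
    finally show "v $ k = (\<Sum>i\<in>{i\<in>{..<d}. P i}. ((K *\<^sub>v z i) \<bullet> v) * z i $ k)" .
  qed (use mem Kz Kz_prod z orth in auto)
  have inf: "gen_multiplicity_infinity K N = card {i\<in>{..<d}. \<nu> i = 0}"
    unfolding gen_multiplicity_infinity_def gen_eigenspace_infinity_def carrier_matD(2)[OF K(1)]
  proof (rule dim[OF N(1)])
    fix i assume i: "i < d" "\<nu> i = 0"
    have "N *\<^sub>v z i = 0\<^sub>v d"
      using eig[OF i(1)] Kz[OF i(1)] i(2) K(1) by (intro eq_vecI) auto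
    then show "z i \<in> mat_kernel N"
      using z[OF i(1)] by (intro mat_kernelI[OF N(1)])
  next
    fix v i assume v: "v \<in> mat_kernel N" "i < d" "\<nu> i \<noteq> 0"
    then have "v \<in> carrier_vec d" "N *\<^sub>v v = 0\<^sub>v d" using mat_kernelD[OF N(1)] by auto
    then show "z i \<bullet> (K *\<^sub>v v) = 0"
      using Nz_prod[of i v] z[of i] v(2,3) by simp
  qed
  have eigen_coeff: "z i \<bullet> (K *\<^sub>v v) = 0"
    if "v \<in> gen_eigenspace K N \<mu>" "i < d" "\<mu> * \<nu> i \<noteq> 1" for v i \<mu>
  proof -
    have v: "v \<in> carrier_vec d" "K *\<^sub>v v = \<mu> \<cdot>\<^sub>v (N *\<^sub>v v)"
      using that(1) K by (auto simp: gen_eigenspace_def)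
    have "z i \<bullet> (K *\<^sub>v v) = \<mu> * (z i \<bullet> (N *\<^sub>v v))"
      using v(1) z[OF that(2)] N by (simp add: v(2))
    \<comment> \<open>This is the eigenvalue equation in the coordinate \<open>i\<close>, where the
      pencil is diagonal.\<close>
    then have "(1 - \<mu> * \<nu> i) * (z i \<bullet> (K *\<^sub>v v)) = 0"
      using Nz_prod[OF that(2) v(1)] by (simp add: algebra_simps)
    then show ?thesis using that(3) by simp
  qed
  have eigen_mem: "z i \<in> gen_eigenspace K N \<mu>" if "i < d" "\<mu> * \<nu> i = 1" for i \<mu>
    using K Kz[OF that(1)] z[OF that(1)] eig[OF that(1)] that(2)
    by (simp add: gen_eigenspace_def smult_smult_assoc)
  have mult: "gen_multiplicity K N \<mu> = card {i\<in>{..<d}. \<mu> * \<nu> i = 1}" for \<mu>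
    unfolding gen_multiplicity_def gen_eigenspace_eq_mat_kernel[OF K(1) N(1)] carrier_matD(2)[OF K(1)]
    by (rule dim[OF A])
      (use eigen_mem eigen_coeff in \<open>auto simp: gen_eigenspace_eq_mat_kernel[OF K(1) N(1)]\<close>)
  define J where "J = {i\<in>{..<d}. \<nu> i \<noteq> 0}"
  have "gen_eigenvalue K N \<mu> \<longleftrightarrow> (\<exists>i<d. \<mu> * \<nu> i = 1)" for \<mu>
  proof
    assume "gen_eigenvalue K N \<mu>"
    then obtain v where v: "v \<in> gen_eigenspace K N \<mu>" "v \<noteq> 0\<^sub>v d" "v \<in> carrier_vec d"
      using K by (auto simp: gen_eigenvalue_def gen_eigenspace_def)
    show "\<exists>i<d. \<mu> * \<nu> i = 1"
    proof (rule ccontr)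
      assume "\<not> (\<exists>i<d. \<mu> * \<nu> i = 1)"
      then have "z i \<bullet> (K *\<^sub>v v) = 0" if "i < d" for i
        using eigen_coeff[OF v(1) that] that by blast
      then have "vec d (\<lambda>k. \<Sum>i<d. (z i \<bullet> (K *\<^sub>v v)) * z i $ k) = 0\<^sub>v d"
        by (intro eq_vecI) auto
      then show False using expand[OF v(3)] v(2) by simp
    qed
  next
    assume "\<exists>i<d. \<mu> * \<nu> i = 1"
    then obtain i where i: "i < d" "\<mu> * \<nu> i = 1" by blast
    have "z i \<noteq> 0\<^sub>v d" using orth[OF i(1) i(1)] Kz[OF i(1)] by auto
    then show "gen_eigenvalue K N \<mu>"
      using eigen_mem[OF i] K by (auto simp: gen_eigenvalue_def)
  qed
  moreover have "\<mu> * \<nu> i = 1 \<longleftrightarrow> \<nu> i \<noteq> 0 \<and> \<mu> = 1 / \<nu> i" for \<mu> i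
    by (cases "\<nu> i = 0") (auto simp: nonzero_eq_divide_eq)
  ultimately have spec: "{\<mu>. gen_eigenvalue K N \<mu>} = (\<lambda>i. 1 / \<nu> i) ` J"
    by (auto simp: J_def)
  have J: "finite J" by (simp add: J_def)
  then show "finite {\<mu>. gen_eigenvalue K N \<mu>}" unfolding spec by simp
  \<comment> \<open>The indices in \<open>J\<close> are grouped by the value of
    \<open>1 / \<nu> i\<close>; the size of each fibre is the multiplicity of that
    eigenvalue.\<close>
  have "(\<Sum>\<mu> | gen_eigenvalue K N \<mu>. gen_multiplicity K N \<mu>) = (\<Sum>\<mu>\<in>(\<lambda>i. 1 / \<nu> i) ` J. \<Sum>i\<in>{i. i \<in> J \<and> 1 / \<nu> i = \<mu>}. 1)"
    unfolding spec mult
    by (rule sum.cong) (auto simp: J_def intro!: arg_cong[of _ _ card])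
  also have "\<dots> = card J"
    using sum.image_gen[OF J, of "\<lambda>_. 1::nat" "\<lambda>i. 1 / \<nu> i"] by simp
  finally have "(\<Sum>\<mu> | gen_eigenvalue K N \<mu>. gen_multiplicity K N \<mu>) + gen_multiplicity_infinity K N
      = card J + card {i\<in>{..<d}. \<nu> i = 0}"
    using inf by simp
  also have "\<dots> = card (J \<union> {i\<in>{..<d}. \<nu> i = 0})"
    using J by (intro card_Un_disjoint[symmetric]) (auto simp: J_def)
  also have "J \<union> {i\<in>{..<d}. \<nu> i = 0} = {..<d}" by (auto simp: J_def)
  finally show "(\<Sum>\<mu> | gen_eigenvalue K N \<mu>. gen_multiplicity K N \<mu>) + gen_multiplicity_infinity K N = d"
    by simp
qed

section \<open>Square-integrable functions\<close>

lemma L2_bounded_continuous: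
  fixes f :: "'a::euclidean_space \<Rightarrow> 'b::euclidean_space"
  assumes "open \<Omega>" "bounded \<Omega>" "continuous_on UNIV f"
  shows "f \<in> L2 \<Omega>"
proof -
  have \<Omega>: "\<Omega> \<in> lmeasurable"
    using assms by (simp add: lmeasurable_open)
  then have fm: "finite_measure (lebesgue_on \<Omega>)"
    by (rule finite_measure_lebesgue_on)
  have meas: "f \<in> borel_measurable (lebesgue_on \<Omega>)"
    using assms \<Omega> by (intro continuous_imp_measurable_on_sets_lebesgue fmeasurableD) (auto intro: continuous_on_subset)
  have "compact (f ` closure \<Omega>)"
    using assms by (intro compact_continuous_image) (auto simp: compact_closure intro: continuous_on_subset)
  then obtain B where "\<forall>y\<in>f ` closure \<Omega>. norm y \<le> B"
    using compact_imp_bounded bounded_iff by blast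
  then have B: "norm (f x) \<le> B" if "x \<in> \<Omega>" for x
    using that closure_subset by blast
  interpret finite_measure "lebesgue_on \<Omega>" by (rule fm)
  have "integrable (lebesgue_on \<Omega>) (\<lambda>x. (norm (f x))\<^sup>2)"
    using meas B by (intro integrable_const_bound[of _ "B\<^sup>2"]) (auto intro!: AE_I2 power_mono)
  with meas show ?thesis by (simp add: L2_def)
qed

lemma L2_add:
  assumes "f \<in> L2 \<Omega>" "g \<in> L2 \<Omega>"
  shows "(\<lambda>x. f x + g x) \<in> L2 \<Omega>"
proof -
  have "integrable (lebesgue_on \<Omega>) (\<lambda>x. (norm (f x + g x))\<^sup>2)"
  proof (rule Bochner_Integration.integrable_bound)
    show "integrable (lebesgue_on \<Omega>) (\<lambda>x. 2 * (norm (f x))\<^sup>2 + 2 * (norm (g x))\<^sup>2)"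
      using assms by (auto simp: L2_def)
    have "(norm (f x + g x))\<^sup>2 \<le> 2 * (norm (f x))\<^sup>2 + 2 * (norm (g x))\<^sup>2" for x
    proof -
      have "(norm (f x + g x))\<^sup>2 \<le> (norm (f x) + norm (g x))\<^sup>2"
        by (intro power_mono norm_triangle_ineq) auto
      also have "\<dots> \<le> 2 * (norm (f x))\<^sup>2 + 2 * (norm (g x))\<^sup>2"
        using zero_le_power2[of "norm (f x) - norm (g x)"] by (simp add: power2_eq_square algebra_simps)
      finally show ?thesis .
    qed
    then show "AE x in lebesgue_on \<Omega>. norm ((norm (f x + g x))\<^sup>2) \<le> norm (2 * (norm (f x))\<^sup>2 + 2 * (norm (g x))\<^sup>2)"
      by (intro AE_I2) (simp add: add_nonneg_nonneg)
  qed (use assms in \<open>auto simp: L2_def\<close>)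
  then show ?thesis using assms by (auto simp: L2_def)
qed

lemma L2_scaleR: "f \<in> L2 \<Omega> \<Longrightarrow> (\<lambda>x. c *\<^sub>R f x) \<in> L2 \<Omega>"
  by (auto simp: L2_def power_mult_distrib)

lemma L2_zero: "(\<lambda>x. 0) \<in> L2 \<Omega>"
  by (simp add: L2_def)

lemma L2_diff: "f \<in> L2 \<Omega> \<Longrightarrow> g \<in> L2 \<Omega> \<Longrightarrow> (\<lambda>x. f x - g x) \<in> L2 \<Omega>"
  using L2_add[OF _ L2_scaleR[of g _ "-1"]] by simp

lemma L2_sum: "finite I \<Longrightarrow> (\<And>i. i \<in> I \<Longrightarrow> f i \<in> L2 \<Omega>) \<Longrightarrow> (\<lambda>x. \<Sum>i\<in>I. f i x) \<in> L2 \<Omega>"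
  by (induction I rule: finite_induct) (auto simp: L2_zero L2_add)

lemma L2_sum_scaleR: 
  "finite I \<Longrightarrow> (\<And>i. i \<in> I \<Longrightarrow> f i \<in> L2 \<Omega>) \<Longrightarrow> (\<lambda>x. \<Sum>i\<in>I. c i *\<^sub>R f i x) \<in> L2 \<Omega>"
  by (intro L2_sum L2_scaleR)

lemma L2_bounded_mult:
  fixes a :: "'a::euclidean_space \<Rightarrow> real" and f :: "'a \<Rightarrow> 'b::euclidean_space"
  assumes "f \<in> L2 \<Omega>" "a \<in> borel_measurable (lebesgue_on \<Omega>)" "\<And>x. x \<in> \<Omega> \<Longrightarrow> \<bar>a x\<bar> \<le> R"
  shows "(\<lambda>x. a x *\<^sub>R f x) \<in> L2 \<Omega>"
proof -
  have "integrable (lebesgue_on \<Omega>) (\<lambda>x. (norm (a x *\<^sub>R f x))\<^sup>2)"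
  proof (rule Bochner_Integration.integrable_bound)
    show "integrable (lebesgue_on \<Omega>) (\<lambda>x. R\<^sup>2 * (norm (f x))\<^sup>2)"
      using assms by (auto simp: L2_def)
    have "(norm (a x *\<^sub>R f x))\<^sup>2 \<le> R\<^sup>2 * (norm (f x))\<^sup>2" if "x \<in> \<Omega>" for x
      unfolding norm_scaleR power_mult_distrib
      using power_mono[OF assms(3)[OF that], of 2] by (intro mult_right_mono) auto
    then show "AE x in lebesgue_on \<Omega>. norm ((norm (a x *\<^sub>R f x))\<^sup>2) \<le> norm (R\<^sup>2 * (norm (f x))\<^sup>2)"
      by (intro AE_I2) auto
  qed (use assms in \<open>auto simp: L2_def\<close>)
  then show ?thesis using assms by (auto simp: L2_def)
qed

text \<open>A coordinate is bounded on a bounded set, hence an admissible weight. This supplies the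
  weighted functions in \<open>weak_gradient_moment_identity\<close>.\<close>

lemma L2_coordinate_mult:
  fixes f :: "'a::euclidean_space \<Rightarrow> 'b::euclidean_space"
  assumes \<Omega>: "open \<Omega>" "bounded \<Omega>" and b: "b \<in> Basis" and f: "f \<in> L2 \<Omega>"
  shows "(\<lambda>x. inner x b *\<^sub>R f x) \<in> L2 \<Omega>"
proof -
  obtain R where R: "\<And>x. x \<in> \<Omega> \<Longrightarrow> norm x \<le> R"
    using \<Omega> by (auto simp: bounded_iff)
  have R': "\<bar>inner x b\<bar> \<le> R" if "x \<in> \<Omega>" for x
    using R[OF that] Basis_le_norm[OF b, of x] by simp
  have meas: "(\<lambda>x. inner x b) \<in> borel_measurable (lebesgue_on \<Omega>)"
    using \<Omega> by (intro continuous_imp_measurable_on_sets_lebesgue continuous_intros) auto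
  show ?thesis by (rule L2_bounded_mult[OF f meas R'])
qed

lemma L2_inner_const:
  fixes f :: "'a::euclidean_space \<Rightarrow> 'b::euclidean_space"
  assumes "f \<in> L2 \<Omega>"
  shows "(\<lambda>x. inner (f x) b) \<in> L2 \<Omega>"
proof -
  have "integrable (lebesgue_on \<Omega>) (\<lambda>x. (norm (inner (f x) b))\<^sup>2)"
  proof (rule Bochner_Integration.integrable_bound)
    show "integrable (lebesgue_on \<Omega>) (\<lambda>x. (norm b)\<^sup>2 * (norm (f x))\<^sup>2)"
      using assms by (auto simp: L2_def)
    have "(norm (inner (f x) b))\<^sup>2 \<le> (norm b)\<^sup>2 * (norm (f x))\<^sup>2" for x
      using power_mono[OF Cauchy_Schwarz_ineq2[of "f x" b], of 2] by (simp add: power_mult_distrib mult.commute)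
    then show "AE x in lebesgue_on \<Omega>. norm ((norm (inner (f x) b))\<^sup>2) \<le> norm ((norm b)\<^sup>2 * (norm (f x))\<^sup>2)"
      by (intro AE_I2) auto
  qed (use assms in \<open>auto simp: L2_def\<close>)
  then show ?thesis using assms by (auto simp: L2_def)
qed

lemma L2_scaleR_const:
  fixes f :: "'a::euclidean_space \<Rightarrow> real" and b :: "'b::euclidean_space"
  assumes "f \<in> L2 \<Omega>"
  shows "(\<lambda>x. f x *\<^sub>R b) \<in> L2 \<Omega>"
  using assms borel_measurable_scaleR[of f "lebesgue_on \<Omega>" "\<lambda>_. b"]
  by (simp add: L2_def power_mult_distrib)

lemma integrable_L2_inner:
  assumes "f \<in> L2 \<Omega>" "g \<in> L2 \<Omega>"
  shows "integrable (lebesgue_on \<Omega>) (\<lambda>x. inner (f x) (g x))"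
proof (rule Bochner_Integration.integrable_bound)
  show "integrable (lebesgue_on \<Omega>) (\<lambda>x. (norm (f x))\<^sup>2 + (norm (g x))\<^sup>2)"
    using assms by (auto simp: L2_def)
  have "\<bar>inner (f x) (g x)\<bar> \<le> (norm (f x))\<^sup>2 + (norm (g x))\<^sup>2" for x
  proof -
    have "\<bar>inner (f x) (g x)\<bar> \<le> norm (f x) * norm (g x)"
      by (rule Cauchy_Schwarz_ineq2)
    also have "2 * (norm (f x) * norm (g x)) \<le> (norm (f x))\<^sup>2 + (norm (g x))\<^sup>2"
      using zero_le_power2[of "norm (f x) - norm (g x)"] by (simp add: power2_eq_square algebra_simps)
    finally show ?thesis by (smt (verit) mult_nonneg_nonneg norm_ge_zero)
  qed
  then show "AE x in lebesgue_on \<Omega>. norm (inner (f x) (g x)) \<le> norm ((norm (f x))\<^sup>2 + (norm (g x))\<^sup>2)"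
    by (intro AE_I2) auto
qed (use assms in \<open>auto simp: L2_def\<close>)

lemma L2_inner_commute: "L2_inner \<Omega> f g = L2_inner \<Omega> g f"
  by (simp add: L2_inner_def inner_commute)

lemma L2_inner_diff_right:
  "f \<in> L2 \<Omega> \<Longrightarrow> g \<in> L2 \<Omega> \<Longrightarrow> h \<in> L2 \<Omega> \<Longrightarrow>
    L2_inner \<Omega> f (\<lambda>x. g x - h x) = L2_inner \<Omega> f g - L2_inner \<Omega> f h"
  by (simp add: L2_inner_def inner_diff_right integrable_L2_inner)

lemma L2_inner_sum_left:
  assumes "finite I" "\<And>i. i \<in> I \<Longrightarrow> f i \<in> L2 \<Omega>" "g \<in> L2 \<Omega>"
  shows "L2_inner \<Omega> (\<lambda>x. \<Sum>i\<in>I. c i *\<^sub>R f i x) g = (\<Sum>i\<in>I. c i * L2_inner \<Omega> (f i) g)"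
  using assms by (simp add: L2_inner_def inner_sum_left integrable_L2_inner)

lemma L2_inner_sum_right:
  assumes "finite I" "\<And>i. i \<in> I \<Longrightarrow> f i \<in> L2 \<Omega>" "g \<in> L2 \<Omega>"
  shows "L2_inner \<Omega> g (\<lambda>x. \<Sum>i\<in>I. c i *\<^sub>R f i x) = (\<Sum>i\<in>I. c i * L2_inner \<Omega> g (f i))"
  using L2_inner_sum_left[OF assms] by (simp add: L2_inner_commute[of \<Omega> g])

lemma L2_inner_lincomb:
  fixes m n :: nat
  assumes "\<And>j. j < m \<Longrightarrow> f j \<in> L2 \<Omega>" "\<And>i. i < n \<Longrightarrow> g i \<in> L2 \<Omega>"
  shows "L2_inner \<Omega> (\<lambda>z. \<Sum>j<m. x j *\<^sub>R f j z) (\<lambda>z. \<Sum>i<n. y i *\<^sub>R g i z)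
    = (\<Sum>i<n. y i * (\<Sum>j<m. x j * L2_inner \<Omega> (f j) (g i)))"
proof -
  have "L2_inner \<Omega> (\<lambda>z. \<Sum>j<m. x j *\<^sub>R f j z) (\<lambda>z. \<Sum>i<n. y i *\<^sub>R g i z)
      = (\<Sum>i<n. y i * L2_inner \<Omega> (\<lambda>z. \<Sum>j<m. x j *\<^sub>R f j z) (g i))"
    by (rule L2_inner_sum_right) (use assms in \<open>auto intro!: L2_sum_scaleR\<close>)
  also have "\<dots> = (\<Sum>i<n. y i * (\<Sum>j<m. x j * L2_inner \<Omega> (f j) (g i)))"
    by (rule sum.cong[OF refl], subst L2_inner_sum_left) (use assms in auto)
  finally show ?thesis .
qed

lemma L2_inner_cong_AE:
  assumes "f \<in> L2 \<Omega>" "f' \<in> L2 \<Omega>" "g \<in> L2 \<Omega>" "AE x in lebesgue_on \<Omega>. f x = f' x"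
  shows "L2_inner \<Omega> f g = L2_inner \<Omega> f' g"
  unfolding L2_inner_def
  by (rule integral_cong_AE) (use assms integrable_L2_inner in \<open>auto\<close>)

lemma L2_inner_AE_zero:
  assumes "f \<in> L2 \<Omega>" "g \<in> L2 \<Omega>" "AE x in lebesgue_on \<Omega>. f x = 0"
  shows "L2_inner \<Omega> f g = 0" "L2_inner \<Omega> g f = 0"
proof -
  show "L2_inner \<Omega> f g = 0"
    using L2_inner_cong_AE[OF assms(1) L2_zero assms(2,3)] by (simp add: L2_inner_def)
  then show "L2_inner \<Omega> g f = 0" by (simp add: L2_inner_commute[of \<Omega> g])
qed

lemma L2_inner_self_nonneg: "L2_inner \<Omega> f f \<ge> 0"
  by (simp add: L2_inner_def)

lemma L2_inner_self_eq_0: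
  assumes "f \<in> L2 \<Omega>" "L2_inner \<Omega> f f = 0"
  shows "AE x in lebesgue_on \<Omega>. f x = 0"
  using integral_nonneg_eq_0_iff_AE[OF integrable_L2_inner[OF assms(1,1)]] assms(2)
  by (simp add: L2_inner_def)

lemma L2_Cauchy_Schwarz:
  assumes f: "f \<in> L2 \<Omega>" and g: "g \<in> L2 \<Omega>"
  shows "\<bar>L2_inner \<Omega> f g\<bar> \<le> L2_norm \<Omega> f * L2_norm \<Omega> g"
proof -
  let ?a = "L2_inner \<Omega> f f" and ?b = "L2_inner \<Omega> f g" and ?c = "L2_inner \<Omega> g g"
  have quad: "s\<^sup>2 * ?a + 2 * s * t * ?b + t\<^sup>2 * ?c \<ge> 0" for s t
  proof -
    have "0 \<le> L2_inner \<Omega> (\<lambda>x. s *\<^sub>R f x + t *\<^sub>R g x) (\<lambda>x. s *\<^sub>R f x + t *\<^sub>R g x)"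
      by (rule L2_inner_self_nonneg)
    also have "\<dots> = (LINT x|lebesgue_on \<Omega>. s\<^sup>2 * inner (f x) (f x) + 2 * s * t * inner (f x) (g x) + t\<^sup>2 * inner (g x) (g x))"
      unfolding L2_inner_def
      by (rule Bochner_Integration.integral_cong) (auto simp: inner_add inner_commute power2_eq_square algebra_simps)
    also have "\<dots> = s\<^sup>2 * ?a + 2 * s * t * ?b + t\<^sup>2 * ?c"
      using f g by (simp add: integrable_L2_inner L2_inner_def)
    finally show ?thesis .
  qed
  have "?b\<^sup>2 \<le> ?a * ?c"
  proof (cases "?a = 0")
    case True
    have "AE x in lebesgue_on \<Omega>. f x = 0" by (rule L2_inner_self_eq_0[OF f True])
    then have "?b = L2_inner \<Omega> (\<lambda>x. 0) g" by (intro L2_inner_cong_AE f g L2_zero) auto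
    then show ?thesis using True by (simp add: L2_inner_def)
  next
    case False
    then have a: "?a > 0" using L2_inner_self_nonneg[of \<Omega> f] by simp
    \<comment> \<open>For these \<open>s\<close> and \<open>t\<close> the combination is
      \<open>- ?a\<close> times the part of \<open>g\<close> orthogonal to \<open>f\<close>, which
      avoids a division.\<close>
    have "0 \<le> ?b\<^sup>2 * ?a + 2 * ?b * (- ?a) * ?b + (- ?a)\<^sup>2 * ?c"
      by (rule quad)
    also have "\<dots> = ?a * (?a * ?c - ?b\<^sup>2)"
      by (simp add: power2_eq_square algebra_simps)
    finally show ?thesis using a by (simp add: zero_le_mult_iff)
  qed
  then have "sqrt (?b\<^sup>2) \<le> sqrt (?a * ?c)" by (rule real_sqrt_le_mono)
  then show ?thesis by (simp add: L2_norm_def real_sqrt_mult)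
qed

lemma L2_inner_tendsto_right:
  assumes f: "f \<in> L2 \<Omega>" and g: "g \<in> L2 \<Omega>" and h: "\<And>k. h k \<in> L2 \<Omega>"
    and lim: "(\<lambda>k. L2_norm \<Omega> (\<lambda>x. g x - h k x)) \<longlonglongrightarrow> 0"
  shows "(\<lambda>k. L2_inner \<Omega> f (h k)) \<longlonglongrightarrow> L2_inner \<Omega> f g"
proof -
  have "(\<lambda>k. L2_inner \<Omega> f g - L2_inner \<Omega> f (h k)) \<longlonglongrightarrow> 0"
  proof (rule Lim_null_comparison)
    show "(\<lambda>k. L2_norm \<Omega> f * L2_norm \<Omega> (\<lambda>x. g x - h k x)) \<longlonglongrightarrow> 0"
      using tendsto_mult_left[OF lim, of "L2_norm \<Omega> f"] by simp
    show "\<forall>\<^sub>F k in sequentially. norm (L2_inner \<Omega> f g - L2_inner \<Omega> f (h k)) \<le> L2_norm \<Omega> f * L2_norm \<Omega> (\<lambda>x. g x - h k x)"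
      using L2_Cauchy_Schwarz[OF f L2_diff[OF g h]] L2_inner_diff_right[OF f g h] by simp
  qed
  from tendsto_diff[OF tendsto_const[of "L2_inner \<Omega> f g"] this] show ?thesis by simp
qed

section \<open>Test functions and weak derivatives\<close>

lemma Ck_SucD: "Ck (Suc k) f \<Longrightarrow> Ck k f"
proof (induction k arbitrary: f)
  case 0
  then show ?case by (auto simp: continuous_on_eq_continuous_at intro: differentiable_imp_continuous_within)
next
  case (Suc k)
  then show ?case by (metis Ck.simps(2))
qed

lemma Ck_add: "Ck k f \<Longrightarrow> Ck k g \<Longrightarrow> Ck k (\<lambda>x. f x + g x)"
proof (induction k arbitrary: f g)
  case (Suc k)
  have "frechet_derivative (\<lambda>x. f x + g x) (at x) = (\<lambda>v. frechet_derivative f (at x) v + frechet_derivative g (at x) v)" for x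
    using Suc.prems by (intro frechet_derivative_at[symmetric] has_derivative_add) (auto simp: frechet_derivative_works)
  then show ?case using Suc by auto
qed (auto intro: continuous_intros)

lemma Ck_cmult: "Ck k f \<Longrightarrow> Ck k (\<lambda>x. c * f x)"
proof (induction k arbitrary: f)
  case (Suc k)
  have "frechet_derivative (\<lambda>x. c * f x) (at x) = (\<lambda>v. c * frechet_derivative f (at x) v)" for x
    using Suc.prems by (intro frechet_derivative_at[symmetric] has_derivative_mult_right) (auto simp: frechet_derivative_works)
  then show ?case using Suc by auto
qed (auto intro: continuous_intros)

lemma frechet_derivative_inner_mult:
  fixes f :: "'a::euclidean_space \<Rightarrow> real"
  assumes "f differentiable (at x)"
  shows "frechet_derivative (\<lambda>x. inner x b * f x) (at x) = (\<lambda>v. inner x b * frechet_derivative f (at x) v + inner v b * f x)"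
proof (rule frechet_derivative_at[symmetric])
  have "(f has_derivative frechet_derivative f (at x)) (at x)"
    using assms by (simp add: frechet_derivative_works)
  moreover have "((\<lambda>x. inner x b) has_derivative (\<lambda>v. inner v b)) (at x)"
    by (auto intro!: derivative_eq_intros)
  ultimately show "((\<lambda>x. inner x b * f x) has_derivative (\<lambda>v. inner x b * frechet_derivative f (at x) v + inner v b * f x)) (at x)"
    by (rule has_derivative_mult[rotated])
qed

text \<open>The product rule returns \<open>f\<close> itself next to its derivative, and it is
  wanted there at one order less than assumed; \<open>Ck_SucD\<close> provides that.\<close>

lemma Ck_inner_mult: "Ck k f \<Longrightarrow> Ck k (\<lambda>x. inner x b * f x)"
proof (induction k arbitrary: f)
  case (Suc k)
  have "(\<lambda>x. inner x b * f x) differentiable (at x)" for x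
    using Suc.prems by (intro differentiable_mult[OF bounded_linear_imp_differentiable[OF bounded_linear_inner_left]]) auto
  moreover have "Ck k (\<lambda>x. inner x b * frechet_derivative f (at x) v + inner v b * f x)" for v
    by (rule Ck_add[OF Suc.IH Ck_cmult[OF Ck_SucD[OF Suc.prems]]]) (use Suc.prems in simp)
  ultimately show ?case
    using Suc.prems by (simp add: frechet_derivative_inner_mult)
qed (auto intro!: continuous_intros)

lemma test_functions_inner_mult:
  assumes "\<phi> \<in> test_functions \<Omega>"
  shows "(\<lambda>x. inner x b * \<phi> x) \<in> test_functions \<Omega>"
proof -
  have "closure {x. inner x b * \<phi> x \<noteq> 0} \<subseteq> closure {x. \<phi> x \<noteq> 0}"
    by (rule closure_mono) auto
  then show ?thesis
    using assms compact_Int_closed[of "closure {x. \<phi> x \<noteq> 0}" "closure {x. inner x b * \<phi> x \<noteq> 0}"]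
    by (auto simp: test_functions_def Ck_inner_mult Int_absorb1)
qed

lemma test_functions_differentiable: "\<phi> \<in> test_functions \<Omega> \<Longrightarrow> \<phi> differentiable (at x)"
  by (auto simp: test_functions_def dest: spec[of _ "Suc 0"])

lemma test_functions_continuous: "\<phi> \<in> test_functions \<Omega> \<Longrightarrow> continuous_on UNIV \<phi>"
  by (auto simp: test_functions_def dest: spec[of _ 0])

lemma gradient_test_function_continuous: "\<phi> \<in> test_functions \<Omega> \<Longrightarrow> continuous_on UNIV (gradient \<phi>)"
  unfolding gradient_def
  by (intro continuous_intros) (auto simp: test_functions_def dest: spec[of _ "Suc 0"])

lemma test_functions_L2:
  assumes "open \<Omega>" "bounded \<Omega>" "\<phi> \<in> test_functions \<Omega>"
  shows "\<phi> \<in> L2 \<Omega>" "gradient \<phi> \<in> L2 \<Omega>"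
  using assms by (auto intro!: L2_bounded_continuous test_functions_continuous gradient_test_function_continuous)

lemma inner_gradient: "b \<in> Basis \<Longrightarrow> inner (gradient \<phi> x) b = frechet_derivative \<phi> (at x) b"
  by (simp add: gradient_def inner_sum_left inner_Basis if_distrib cong: if_cong)

section \<open>From test functions to \<open>H10\<close> by density\<close>

lemma H10_weak_grad: "p \<in> H10 \<Omega> \<Longrightarrow> has_weak_gradient \<Omega> p (weak_grad \<Omega> p)"
  unfolding weak_grad_def by (rule someI_ex[of "has_weak_gradient \<Omega> p"]) (simp add: H10_def H1_def)

lemma Hdiv_weak_div: "s \<in> Hdiv \<Omega> \<Longrightarrow> has_weak_div \<Omega> s (weak_div \<Omega> s)"
  unfolding weak_div_def by (rule someI_ex[of "has_weak_div \<Omega> s"]) (simp add: Hdiv_def)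

lemma H10_approximating_sequence:
  assumes "p \<in> H10 \<Omega>"
  obtains \<phi> where "\<And>k. \<phi> k \<in> test_functions \<Omega>"
    "(\<lambda>k. L2_norm \<Omega> (\<lambda>x. p x - \<phi> k x)) \<longlonglongrightarrow> 0"
    "(\<lambda>k. L2_norm \<Omega> (\<lambda>x. weak_grad \<Omega> p x - gradient (\<phi> k) x)) \<longlonglongrightarrow> 0"
proof -
  have "\<exists>\<phi>\<in>test_functions \<Omega>. sqrt ((L2_norm \<Omega> (\<lambda>x. p x - \<phi> x))\<^sup>2
      + (L2_norm \<Omega> (\<lambda>x. weak_grad \<Omega> p x - gradient \<phi> x))\<^sup>2) < 1 / real (Suc k)" for k
    using assms unfolding H10_def by simp
  then obtain \<phi> where \<phi>: "\<And>k. \<phi> k \<in> test_functions \<Omega>" and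
    small: "\<And>k. sqrt ((L2_norm \<Omega> (\<lambda>x. p x - \<phi> k x))\<^sup>2
      + (L2_norm \<Omega> (\<lambda>x. weak_grad \<Omega> p x - gradient (\<phi> k) x))\<^sup>2) < 1 / real (Suc k)"
    by metis
  have "\<bar>L2_norm \<Omega> (\<lambda>x. p x - \<phi> k x)\<bar> \<le> 1 / real (Suc k)"
    "\<bar>L2_norm \<Omega> (\<lambda>x. weak_grad \<Omega> p x - gradient (\<phi> k) x)\<bar> \<le> 1 / real (Suc k)" for k
    using small[of k] real_sqrt_sum_squares_ge1 real_sqrt_sum_squares_ge2
    by (smt (verit) real_sqrt_abs real_sqrt_le_iff zero_le_power2)+
  then show thesis
    by (intro that[of \<phi>] \<phi> Lim_null_comparison[OF _ LIMSEQ_inverse_real_of_nat])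
      (auto simp: inverse_eq_divide)
qed

text \<open>A single sequence serves every \<open>f\<close> and both the function and its gradient,
  so an identity that links the pairings with a test function and with its gradient passes to the
  limit term by term.\<close>

lemma H10_tendsto:
  assumes \<Omega>: "open \<Omega>" "bounded \<Omega>" and p: "p \<in> H10 \<Omega>"
  obtains \<phi> where "\<And>k. \<phi> k \<in> test_functions \<Omega>"
    "\<And>f. f \<in> L2 \<Omega> \<Longrightarrow> (\<lambda>k. L2_inner \<Omega> f (\<phi> k)) \<longlonglongrightarrow> L2_inner \<Omega> f p"
    "\<And>f. f \<in> L2 \<Omega> \<Longrightarrow> (\<lambda>k. L2_inner \<Omega> f (gradient (\<phi> k))) \<longlonglongrightarrow> L2_inner \<Omega> f (weak_grad \<Omega> p)"
proof -
  obtain \<phi> where \<phi>: "\<And>k. \<phi> k \<in> test_functions \<Omega>"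
    "(\<lambda>k. L2_norm \<Omega> (\<lambda>x. p x - \<phi> k x)) \<longlonglongrightarrow> 0"
    "(\<lambda>k. L2_norm \<Omega> (\<lambda>x. weak_grad \<Omega> p x - gradient (\<phi> k) x)) \<longlonglongrightarrow> 0"
    using H10_approximating_sequence[OF p] by blast
  have "p \<in> L2 \<Omega>" "weak_grad \<Omega> p \<in> L2 \<Omega>"
    using p H10_weak_grad[OF p] by (auto simp: H10_def H1_def has_weak_gradient_def)
  moreover have "\<phi> k \<in> L2 \<Omega>" "gradient (\<phi> k) \<in> L2 \<Omega>" for k
    by (rule test_functions_L2[OF \<Omega> \<phi>(1)])+
  ultimately show thesis
    using \<phi> by (intro that[of \<phi>]) (auto intro!: L2_inner_tendsto_right)
qed

text \<open>For test functions in place of \<open>p\<close> this is the definition of the weak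
  divergence, and both sides are limits along the approximating sequence. There is no boundary term
  because \<open>H10\<close> encodes a zero trace.\<close>

lemma weak_div_integration_by_parts:
  assumes \<Omega>: "open \<Omega>" "bounded \<Omega>" and p: "p \<in> H10 \<Omega>" and s: "s \<in> Hdiv \<Omega>"
  shows "L2_inner \<Omega> s (weak_grad \<Omega> p) = - L2_inner \<Omega> (weak_div \<Omega> s) p"
proof -
  obtain \<phi> where \<phi>: "\<And>k. \<phi> k \<in> test_functions \<Omega>"
    "\<And>f. f \<in> L2 \<Omega> \<Longrightarrow> (\<lambda>k. L2_inner \<Omega> f (\<phi> k)) \<longlonglongrightarrow> L2_inner \<Omega> f p"
    "\<And>f. f \<in> L2 \<Omega> \<Longrightarrow> (\<lambda>k. L2_inner \<Omega> f (gradient (\<phi> k))) \<longlonglongrightarrow> L2_inner \<Omega> f (weak_grad \<Omega> p)"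
    using H10_tendsto[OF \<Omega> p] by blast
  have w: "weak_div \<Omega> s \<in> L2 \<Omega>"
    and ibp: "\<And>k. L2_inner \<Omega> s (gradient (\<phi> k)) = - L2_inner \<Omega> (weak_div \<Omega> s) (\<phi> k)"
    using Hdiv_weak_div[OF s] \<phi>(1) by (auto simp: has_weak_div_def)
  have "s \<in> L2 \<Omega>" using s by (simp add: Hdiv_def)
  from \<phi>(3)[OF this] tendsto_minus[OF \<phi>(2)[OF w]] show ?thesis
    unfolding ibp by (rule LIMSEQ_unique)
qed

text \<open>Substitute for the Poincare inequality: \<open>(x \<bullet> b) \<phi>\<close> is a test function whose \<open>b\<close>-derivative
  contains \<open>\<phi>\<close>, so a vanishing weak gradient \<open>g\<close> forces \<open>p\<close> to be orthogonal to \<open>q\<close> up to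
  a term in the weak gradient of \<open>q\<close>.\<close>

lemma weak_gradient_moment_identity:
  assumes \<Omega>: "open \<Omega>" "bounded \<Omega>" and p: "p \<in> L2 \<Omega>" "has_weak_gradient \<Omega> p g"
    and q: "q \<in> H10 \<Omega>" and b: "b \<in> Basis"
  shows "L2_inner \<Omega> (\<lambda>x. (inner x b * p x) *\<^sub>R b) (weak_grad \<Omega> q) + L2_inner \<Omega> p q
    = - L2_inner \<Omega> (\<lambda>x. inner x b *\<^sub>R inner (g x) b) q"
proof -
  obtain \<phi> where \<phi>: "\<And>k. \<phi> k \<in> test_functions \<Omega>"
    "\<And>f. f \<in> L2 \<Omega> \<Longrightarrow> (\<lambda>k. L2_inner \<Omega> f (\<phi> k)) \<longlonglongrightarrow> L2_inner \<Omega> f q"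
    "\<And>f. f \<in> L2 \<Omega> \<Longrightarrow> (\<lambda>k. L2_inner \<Omega> f (gradient (\<phi> k))) \<longlonglongrightarrow> L2_inner \<Omega> f (weak_grad \<Omega> q)"
    using H10_tendsto[OF \<Omega> q] by blast
  have "g \<in> L2 \<Omega>" using p by (simp add: has_weak_gradient_def)
  then have 1: "(\<lambda>x. inner x b *\<^sub>R inner (g x) b) \<in> L2 \<Omega>"
    by (rule L2_coordinate_mult[OF \<Omega> b L2_inner_const])
  have 2: "(\<lambda>x. inner x b *\<^sub>R p x) \<in> L2 \<Omega>"
    by (rule L2_coordinate_mult[OF \<Omega> b p(1)])
  have 3: "(\<lambda>x. (inner x b * p x) *\<^sub>R b) \<in> L2 \<Omega>"
    using L2_scaleR_const[OF 2] by simp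
  have weak: "L2_inner \<Omega> p (\<lambda>x. inner (gradient \<psi> x) b) = - L2_inner \<Omega> (\<lambda>x. inner (g x) b) \<psi>"
    if "\<psi> \<in> test_functions \<Omega>" for \<psi>
    using p(2)[unfolded has_weak_gradient_def, THEN conjunct2, rule_format, OF that b] .
  have eq: "L2_inner \<Omega> (\<lambda>x. (inner x b * p x) *\<^sub>R b) (gradient (\<phi> k)) + L2_inner \<Omega> p (\<phi> k)
      = - L2_inner \<Omega> (\<lambda>x. inner x b *\<^sub>R inner (g x) b) (\<phi> k)" for k
  proof -
    \<comment> \<open>The coordinate multiplies the approximants of \<open>q\<close>, while
      \<open>p\<close> stays fixed and contributes only its weak gradient. Hence the identity can be
      used for each basis function as \<open>q\<close> and summed afterwards.\<close>
    let ?\<psi> = "\<lambda>x. inner x b * \<phi> k x"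
    have L2\<phi>: "\<phi> k \<in> L2 \<Omega>" "gradient (\<phi> k) \<in> L2 \<Omega>"
      by (rule test_functions_L2[OF \<Omega> \<phi>(1)])+
    have pointwise: "inner (p x) (inner (gradient ?\<psi> x) b)
        = inner ((inner x b * p x) *\<^sub>R b) (gradient (\<phi> k) x) + inner (p x) (\<phi> k x)" for x
    proof -
      have "inner (gradient ?\<psi> x) b = inner x b * inner b (gradient (\<phi> k) x) + \<phi> k x"
        unfolding inner_commute[of b "gradient (\<phi> k) x"] inner_gradient[OF b]
          frechet_derivative_inner_mult[OF test_functions_differentiable[OF \<phi>(1)]]
        using b by simp
      then show ?thesis by (simp add: distrib_left)
    qed
    have "L2_inner \<Omega> p (\<lambda>x. inner (gradient ?\<psi> x) b)
        = L2_inner \<Omega> (\<lambda>x. (inner x b * p x) *\<^sub>R b) (gradient (\<phi> k)) + L2_inner \<Omega> p (\<phi> k)"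
      unfolding L2_inner_def pointwise
      by (rule Bochner_Integration.integral_add[OF integrable_L2_inner[OF 3 L2\<phi>(2)] integrable_L2_inner[OF p(1) L2\<phi>(1)]])
    moreover have "L2_inner \<Omega> p (\<lambda>x. inner (gradient ?\<psi> x) b) = - L2_inner \<Omega> (\<lambda>x. inner (g x) b) ?\<psi>"
      by (rule weak) (rule test_functions_inner_mult[OF \<phi>(1)])
    moreover have "L2_inner \<Omega> (\<lambda>x. inner (g x) b) ?\<psi> = L2_inner \<Omega> (\<lambda>x. inner x b *\<^sub>R inner (g x) b) (\<phi> k)"
      by (simp add: L2_inner_def mult.assoc mult.left_commute)
    ultimately show ?thesis by simp
  qed
  have "(\<lambda>k. L2_inner \<Omega> (\<lambda>x. (inner x b * p x) *\<^sub>R b) (gradient (\<phi> k)) + L2_inner \<Omega> p (\<phi> k))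
      \<longlonglongrightarrow> - L2_inner \<Omega> (\<lambda>x. inner x b *\<^sub>R inner (g x) b) q"
    unfolding eq by (rule tendsto_minus[OF \<phi>(2)[OF 1]])
  from LIMSEQ_unique[OF tendsto_add[OF \<phi>(3)[OF 3] \<phi>(2)[OF p(1)]] this] show ?thesis .
qed

text \<open>Linearity holds for the relation \<open>has_weak_gradient\<close>, whereas
  \<open>weak_grad\<close> of the combination may be another representative than the combination of
  the \<open>g i\<close>.\<close>

lemma has_weak_gradient_lincomb:
  fixes c :: "'i \<Rightarrow> real"
  assumes \<Omega>: "open \<Omega>" "bounded \<Omega>" and I: "finite I"
    and p: "\<And>i. i \<in> I \<Longrightarrow> p i \<in> L2 \<Omega>" "\<And>i. i \<in> I \<Longrightarrow> has_weak_gradient \<Omega> (p i) (g i)"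
  shows "has_weak_gradient \<Omega> (\<lambda>x. \<Sum>i\<in>I. c i *\<^sub>R p i x) (\<lambda>x. \<Sum>i\<in>I. c i *\<^sub>R g i x)"
  unfolding has_weak_gradient_def
proof (intro conjI ballI)
  have g: "g i \<in> L2 \<Omega>" if "i \<in> I" for i
    using p(2)[OF that] by (simp add: has_weak_gradient_def)
  then show "(\<lambda>x. \<Sum>i\<in>I. c i *\<^sub>R g i x) \<in> L2 \<Omega>"
    by (rule L2_sum_scaleR[OF I])
  fix \<phi> and b :: 'a assume \<phi>: "\<phi> \<in> test_functions \<Omega>" and b: "b \<in> Basis"
  have "L2_inner \<Omega> (\<lambda>x. \<Sum>i\<in>I. c i *\<^sub>R p i x) (\<lambda>x. inner (gradient \<phi> x) b)
      = (\<Sum>i\<in>I. c i * L2_inner \<Omega> (p i) (\<lambda>x. inner (gradient \<phi> x) b))"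
    by (rule L2_inner_sum_left[OF I p(1) L2_inner_const[OF test_functions_L2(2)[OF \<Omega> \<phi>]]])
  also have "\<dots> = (\<Sum>i\<in>I. c i * (- L2_inner \<Omega> (\<lambda>x. inner (g i x) b) \<phi>))"
    by (rule sum.cong[OF refl]) (use p(2) \<phi> b in \<open>simp add: has_weak_gradient_def\<close>)
  also have "\<dots> = - (\<Sum>i\<in>I. c i * L2_inner \<Omega> (\<lambda>x. inner (g i x) b) \<phi>)"
    by (simp add: sum_negf)
  also have "(\<Sum>i\<in>I. c i * L2_inner \<Omega> (\<lambda>x. inner (g i x) b) \<phi>)
      = L2_inner \<Omega> (\<lambda>x. \<Sum>i\<in>I. c i *\<^sub>R inner (g i x) b) \<phi>"
    by (rule L2_inner_sum_left[OF I L2_inner_const[OF g] test_functions_L2(1)[OF \<Omega> \<phi>], symmetric])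
  also have "(\<lambda>x. \<Sum>i\<in>I. c i *\<^sub>R inner (g i x) b) = (\<lambda>x. inner (\<Sum>i\<in>I. c i *\<^sub>R g i x) b)"
    by (simp add: inner_sum_left)
  finally show "L2_inner \<Omega> (\<lambda>x. \<Sum>i\<in>I. c i *\<^sub>R p i x) (\<lambda>x. inner (gradient \<phi> x) b)
      = - L2_inner \<Omega> (\<lambda>x. inner (\<Sum>i\<in>I. c i *\<^sub>R g i x) b) \<phi>" .
qed

text \<open>The moment identity is applied with the whole combination as \<open>p\<close> and each
  \<open>u i\<close> as \<open>q\<close>, then summed with the weights \<open>c i\<close>. The
  combined gradient appears in both terms other than \<open>(p, p)\<close>, once on each side; as it
  vanishes almost everywhere, \<open>(p, p) = 0\<close> remains.\<close>

lemma H10_lincomb_zero_gradient: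
  fixes c :: "'i \<Rightarrow> real"
  assumes \<Omega>: "open \<Omega>" "bounded \<Omega>" and I: "finite I"
    and u: "\<And>i. i \<in> I \<Longrightarrow> u i \<in> H10 \<Omega>"
    and zero: "AE x in lebesgue_on \<Omega>. (\<Sum>i\<in>I. c i *\<^sub>R weak_grad \<Omega> (u i) x) = 0"
  shows "AE x in lebesgue_on \<Omega>. (\<Sum>i\<in>I. c i *\<^sub>R u i x) = 0"
proof -
  define p where "p x = (\<Sum>i\<in>I. c i *\<^sub>R u i x)" for x
  define g where "g x = (\<Sum>i\<in>I. c i *\<^sub>R weak_grad \<Omega> (u i) x)" for x
  have uL2: "u i \<in> L2 \<Omega>" if "i \<in> I" for i
    using u[OF that] by (simp add: H10_def H1_def)
  have wg: "has_weak_gradient \<Omega> (u i) (weak_grad \<Omega> (u i))" if "i \<in> I" for i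
    by (rule H10_weak_grad[OF u[OF that]])
  then have gL2: "weak_grad \<Omega> (u i) \<in> L2 \<Omega>" if "i \<in> I" for i
    using that by (simp add: has_weak_gradient_def)
  have pg: "has_weak_gradient \<Omega> p g"
    unfolding p_def g_def by (rule has_weak_gradient_lincomb[OF \<Omega> I uL2 wg])
  then have g: "g \<in> L2 \<Omega>" by (simp add: has_weak_gradient_def)
  have p: "p \<in> L2 \<Omega>" unfolding p_def by (rule L2_sum_scaleR[OF I uL2])
  \<comment> \<open>One coordinate direction is enough, as in the Poincare inequality along lines
    parallel to \<open>b\<close>.\<close>
  obtain b :: 'a where b: "b \<in> Basis" using nonempty_Basis by blast
  let ?F = "\<lambda>x. (inner x b * p x) *\<^sub>R b" and ?G = "\<lambda>x. inner x b *\<^sub>R inner (g x) b"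
  have G: "?G \<in> L2 \<Omega>"
    by (rule L2_coordinate_mult[OF \<Omega> b L2_inner_const[OF g]])
  have F: "?F \<in> L2 \<Omega>"
    using L2_scaleR_const[OF L2_coordinate_mult[OF \<Omega> b p]] by simp
  have gz: "AE x in lebesgue_on \<Omega>. g x = 0" using zero by (simp add: g_def)
  then have Gz: "AE x in lebesgue_on \<Omega>. ?G x = 0" by eventually_elim simp
  have sum_g: "L2_inner \<Omega> f g = (\<Sum>i\<in>I. c i * L2_inner \<Omega> f (weak_grad \<Omega> (u i)))" if "f \<in> L2 \<Omega>" for f
    unfolding g_def by (rule L2_inner_sum_right[OF I gL2 that])
  have sum_p: "L2_inner \<Omega> f p = (\<Sum>i\<in>I. c i * L2_inner \<Omega> f (u i))" if "f \<in> L2 \<Omega>" for f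
    unfolding p_def by (rule L2_inner_sum_right[OF I uL2 that])
  have "L2_inner \<Omega> ?F g + L2_inner \<Omega> p p
      = (\<Sum>i\<in>I. c i * (L2_inner \<Omega> ?F (weak_grad \<Omega> (u i)) + L2_inner \<Omega> p (u i)))"
    by (simp add: sum_g[OF F] sum_p[OF p] sum.distrib distrib_left)
  also have "\<dots> = (\<Sum>i\<in>I. c i * (- L2_inner \<Omega> ?G (u i)))"
    by (rule sum.cong[OF refl]) (simp only: weak_gradient_moment_identity[OF \<Omega> p pg u b])
  also have "\<dots> = - L2_inner \<Omega> ?G p"
    by (simp add: sum_p[OF G] sum_negf del: real_scaleR_def)
  also have "\<dots> = 0"
    using L2_inner_AE_zero(1)[OF G p Gz] by simp
  finally have "L2_inner \<Omega> p p = 0"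
    using L2_inner_AE_zero(2)[OF g F gz] by simp
  from L2_inner_self_eq_0[OF p this] show ?thesis by (simp add: p_def)
qed

section \<open>The block pencil of the discretization\<close>

theorem proposition7:
  fixes \<Omega> :: "'a::euclidean_space set"
    and Sh :: "('a \<Rightarrow> 'a) set" and Uh :: "('a \<Rightarrow> real) set"
    and m n :: nat
    and \<sigma> :: "nat \<Rightarrow> 'a \<Rightarrow> 'a" and u :: "nat \<Rightarrow> 'a \<Rightarrow> real"
    and A B C M K N :: "real mat"
  assumes domain: "bounded_lipschitz_domain \<Omega>"
    and Sigma_h: "Sh \<subseteq> Hdiv \<Omega>" "function_subspace Sh" "L2_basis \<Omega> Sh m \<sigma>"
    and U_h: "Uh \<subseteq> H10 \<Omega>" "function_subspace Uh" "L2_basis \<Omega> Uh n u"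
    and A_def: "A = form_mat (form_A \<Omega>) m \<sigma> m \<sigma>"
    and B_def: "B = form_mat (form_B \<Omega>) m \<sigma> n u"
    and C_def: "C = form_mat (form_C \<Omega>) n u n u"
    and M_def: "M = form_mat (L2_inner \<Omega>) n u n u"
    and K_def: "K = four_block_mat A (transpose_mat B) B C"
    and N_def: "N = four_block_mat (0\<^sub>m m m) (0\<^sub>m m n) (0\<^sub>m n m) M"
  shows "invertible_mat K
    \<and> gen_multiplicity_infinity K N = m
    \<and> finite {\<mu>. gen_eigenvalue K N \<mu>}
    \<and> (\<forall>\<mu>. gen_eigenvalue K N \<mu> \<longrightarrow> \<mu> > 0)
    \<and> (\<Sum>\<mu> | gen_eigenvalue K N \<mu>. gen_multiplicity K N \<mu>) = n"
proof -
  have \<Omega>: "open \<Omega>" "bounded \<Omega>"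
    using domain by (auto simp: bounded_lipschitz_domain_def)
  have \<sigma>: "\<sigma> j \<in> Hdiv \<Omega>" if "j < m" for j
    using Sigma_h that by (auto simp: L2_basis_def)
  have u: "u i \<in> H10 \<Omega>" if "i < n" for i
    using U_h that by (auto simp: L2_basis_def)
  have L2: "\<sigma> j \<in> L2 \<Omega>" "weak_div \<Omega> (\<sigma> j) \<in> L2 \<Omega>" if "j < m" for j
    using \<sigma>[OF that] Hdiv_weak_div[OF \<sigma>[OF that]] by (auto simp: Hdiv_def has_weak_div_def)
  have L2u: "u i \<in> L2 \<Omega>" "weak_grad \<Omega> (u i) \<in> L2 \<Omega>" if "i < n" for i
    using u[OF that] H10_weak_grad[OF u[OF that]] by (auto simp: H10_def H1_def has_weak_gradient_def)
  have indep\<sigma>: "\<forall>j<m. c j = 0" if "AE z in lebesgue_on \<Omega>. (\<Sum>j<m. c j *\<^sub>R \<sigma> j z) = 0" for c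
    using Sigma_h(3) that unfolding L2_basis_def by blast
  have indepu: "\<forall>i<n. c i = 0" if "AE z in lebesgue_on \<Omega>. (\<Sum>i<n. c i *\<^sub>R u i z) = 0" for c
    using U_h(3) that unfolding L2_basis_def by blast
  have carrier: "A \<in> carrier_mat m m" "B \<in> carrier_mat n m" "C \<in> carrier_mat n n" "M \<in> carrier_mat n n"
    by (auto simp: A_def B_def C_def M_def form_mat_def)
  have K: "K \<in> carrier_mat (m + n) (m + n)" and N: "N \<in> carrier_mat (m + n) (m + n)"
    using carrier by (auto simp: K_def N_def)
  have sym: "transpose_mat A = A" "transpose_mat C = C" "transpose_mat M = M"
    by (auto simp: A_def C_def M_def form_mat_def form_A_def form_C_def L2_inner_commute intro!: eq_matI)
  have symK: "transpose_mat K = K"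
    using carrier sym by (simp add: K_def transpose_four_block_mat[of _ m m _ n _ n])
  have symN: "transpose_mat N = N"
    using carrier sym by (simp add: N_def transpose_four_block_mat[of _ m m _ n _ n])
  \<comment> \<open>\<open>w x\<close> plays the role of the divergence of \<open>s x\<close>, and
    \<open>g y\<close> that of the gradient of \<open>p y\<close>.\<close>
  define s where "s x = (\<lambda>z. \<Sum>j<m. x $ j *\<^sub>R \<sigma> j z)" for x
  define w where "w x = (\<lambda>z. \<Sum>j<m. x $ j *\<^sub>R weak_div \<Omega> (\<sigma> j) z)" for x
  define p where "p y = (\<lambda>z. \<Sum>i<n. y $ i *\<^sub>R u i z)" for y
  define g where "g y = (\<lambda>z. \<Sum>i<n. y $ i *\<^sub>R weak_grad \<Omega> (u i) z)" for y
  have sL2: "s x \<in> L2 \<Omega>" and wL2: "w x \<in> L2 \<Omega>" and pL2: "p y \<in> L2 \<Omega>" and gL2: "g y \<in> L2 \<Omega>" for x y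
    unfolding s_def w_def p_def g_def by (rule L2_sum_scaleR; use L2 L2u in simp)+
  have expand: "L2_inner \<Omega> (s x) (s x) = (\<Sum>i<m. x $ i * (\<Sum>j<m. x $ j * L2_inner \<Omega> (\<sigma> j) (\<sigma> i)))"
    "L2_inner \<Omega> (w x) (w x)
      = (\<Sum>i<m. x $ i * (\<Sum>j<m. x $ j * L2_inner \<Omega> (weak_div \<Omega> (\<sigma> j)) (weak_div \<Omega> (\<sigma> i))))"
    "L2_inner \<Omega> (s x) (g y)
      = (\<Sum>i<n. y $ i * (\<Sum>j<m. x $ j * L2_inner \<Omega> (\<sigma> j) (weak_grad \<Omega> (u i))))"
    "L2_inner \<Omega> (w x) (p y)
      = (\<Sum>i<n. y $ i * (\<Sum>j<m. x $ j * L2_inner \<Omega> (weak_div \<Omega> (\<sigma> j)) (u i)))"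
    "L2_inner \<Omega> (g y) (g y)
      = (\<Sum>i<n. y $ i * (\<Sum>j<n. y $ j * L2_inner \<Omega> (weak_grad \<Omega> (u j)) (weak_grad \<Omega> (u i))))"
    "L2_inner \<Omega> (p y) (p y) = (\<Sum>i<n. y $ i * (\<Sum>j<n. y $ j * L2_inner \<Omega> (u j) (u i)))" for x y
    unfolding s_def w_def p_def g_def by (rule L2_inner_lincomb; use L2 L2u in simp)+
  have prods: "x \<bullet> (A *\<^sub>v x) = L2_inner \<Omega> (s x) (s x) + L2_inner \<Omega> (w x) (w x)"
    "y \<bullet> (B *\<^sub>v x) = - L2_inner \<Omega> (s x) (g y)"
    "y \<bullet> (C *\<^sub>v y) = L2_inner \<Omega> (g y) (g y)"
    "y \<bullet> (M *\<^sub>v y) = L2_inner \<Omega> (p y) (p y)"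
    if "x \<in> carrier_vec m" "y \<in> carrier_vec n" for x y
    using that
    by (simp_all add: A_def B_def C_def M_def scalar_prod_form_mat expand form_A_def form_B_def form_C_def distrib_left sum.distrib sum_negf)
  \<comment> \<open>This moves the coupling from \<open>g y\<close> to \<open>w x\<close>: once
    \<open>w x\<close> vanishes, the off-diagonal blocks contribute nothing to the quadratic
    form.\<close>
  have green: "L2_inner \<Omega> (s x) (g y) = - L2_inner \<Omega> (w x) (p y)" for x y
    by (simp add: expand sum_negf weak_div_integration_by_parts[OF \<Omega> u \<sigma>])
  have quadK: "(x @\<^sub>v y) \<bullet> (K *\<^sub>v (x @\<^sub>v y)) = L2_inner \<Omega> (s x) (s x) + L2_inner \<Omega> (w x) (w x)
      - 2 * L2_inner \<Omega> (s x) (g y) + L2_inner \<Omega> (g y) (g y)"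
    and quadN: "(x @\<^sub>v y) \<bullet> (N *\<^sub>v (x @\<^sub>v y)) = L2_inner \<Omega> (p y) (p y)"
    if xy: "x \<in> carrier_vec m" "y \<in> carrier_vec n" for x y
  proof -
    have BT: "transpose_mat B \<in> carrier_mat m n" using carrier by simp
    have Kxy: "K *\<^sub>v (x @\<^sub>v y) = (A *\<^sub>v x + transpose_mat B *\<^sub>v y) @\<^sub>v (B *\<^sub>v x + C *\<^sub>v y)"
      unfolding K_def by (rule four_block_mat_mult_vec[OF carrier(1) BT carrier(2,3) xy])
    \<comment> \<open>The two off-diagonal blocks contribute equally, hence the factor 2 in
      \<open>quadK\<close>.\<close>
    have "x \<bullet> (transpose_mat B *\<^sub>v y) = (transpose_mat B *\<^sub>v y) \<bullet> x"
      by (rule comm_scalar_prod[of _ m]) (use BT xy in auto)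
    also have "\<dots> = y \<bullet> (B *\<^sub>v x)"
      by (rule transpose_vec_mult_scalar[OF carrier(2) xy])
    finally show "(x @\<^sub>v y) \<bullet> (K *\<^sub>v (x @\<^sub>v y)) = L2_inner \<Omega> (s x) (s x) + L2_inner \<Omega> (w x) (w x)
      - 2 * L2_inner \<Omega> (s x) (g y) + L2_inner \<Omega> (g y) (g y)"
      using carrier BT xy prods[OF xy] unfolding Kxy
      by (simp add: scalar_prod_append[of _ m _ n] scalar_prod_add_distrib[of _ m] scalar_prod_add_distrib[of _ n])
    have Nxy: "N *\<^sub>v (x @\<^sub>v y) = (0\<^sub>m m m *\<^sub>v x + 0\<^sub>m m n *\<^sub>v y) @\<^sub>v (0\<^sub>m n m *\<^sub>v x + M *\<^sub>v y)"
      unfolding N_def by (rule four_block_mat_mult_vec[OF _ _ _ carrier(4) xy]) auto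
    have zeros: "0\<^sub>m m m *\<^sub>v x + 0\<^sub>m m n *\<^sub>v y = 0\<^sub>v m" "0\<^sub>m n m *\<^sub>v x + M *\<^sub>v y = M *\<^sub>v y"
      using xy carrier(4) by (auto simp: scalar_prod_def intro!: eq_vecI)
    show "(x @\<^sub>v y) \<bullet> (N *\<^sub>v (x @\<^sub>v y)) = L2_inner \<Omega> (p y) (p y)"
      using carrier xy prods(4)[OF xy] unfolding Nxy zeros
      by (simp add: scalar_prod_append[of _ m _ n])
  qed
  have p_zero: "y = 0\<^sub>v n" if "y \<in> carrier_vec n" "AE z in lebesgue_on \<Omega>. p y z = 0" for y
    using indepu[OF that(2)[unfolded p_def]] that(1) by (intro eq_vecI) auto
  have s_zero: "x = 0\<^sub>v m" if "x \<in> carrier_vec m" "AE z in lebesgue_on \<Omega>. s x z = 0" for x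
    using indep\<sigma>[OF that(2)[unfolded s_def]] that(1) by (intro eq_vecI) auto
  have pos: "v \<bullet> (K *\<^sub>v v) > 0" if v: "v \<in> carrier_vec (m + n)" "v \<noteq> 0\<^sub>v (m + n)" for v
  proof (rule ccontr)
    assume neg: "\<not> v \<bullet> (K *\<^sub>v v) > 0"
    define x where "x = vec_first v m"
    define y where "y = vec_last v n"
    have xy: "x \<in> carrier_vec m" "y \<in> carrier_vec n" "v = x @\<^sub>v y"
      using v(1) by (auto simp: x_def y_def)
    have "L2_inner \<Omega> (\<lambda>z. s x z - g y z) (\<lambda>z. s x z - g y z)
        = L2_inner \<Omega> (s x) (s x) - 2 * L2_inner \<Omega> (s x) (g y) + L2_inner \<Omega> (g y) (g y)"
      using L2_inner_diff_right[OF L2_diff[OF sL2[of x] gL2[of y]] sL2[of x] gL2[of y]]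
        L2_inner_diff_right[OF sL2[of x] sL2[of x] gL2[of y]]
        L2_inner_diff_right[OF gL2[of y] sL2[of x] gL2[of y]]
        L2_inner_commute[of \<Omega> "\<lambda>z. s x z - g y z" "s x"] L2_inner_commute[of \<Omega> "\<lambda>z. s x z - g y z" "g y"]
        L2_inner_commute[of \<Omega> "g y" "s x"]
      by linarith
    then have w0: "L2_inner \<Omega> (w x) (w x) = 0"
      using neg quadK[OF xy(1,2)] L2_inner_self_nonneg[of \<Omega> "w x"]
        L2_inner_self_nonneg[of \<Omega> "\<lambda>z. s x z - g y z"] unfolding xy(3) by linarith
    from L2_inner_AE_zero(1)[OF wL2 pL2 L2_inner_self_eq_0[OF wL2 w0]]
    have "L2_inner \<Omega> (s x) (g y) = 0" using green[of x y] by simp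
    \<comment> \<open>Without the coupling term the same quadratic form is a sum of three squared
      norms, so each of them is zero.\<close>
    then have "L2_inner \<Omega> (s x) (s x) = 0" "L2_inner \<Omega> (g y) (g y) = 0"
      using neg quadK[OF xy(1,2)] w0 L2_inner_self_nonneg[of \<Omega> "s x"] L2_inner_self_nonneg[of \<Omega> "g y"]
      unfolding xy(3) by linarith+
    then have "AE z in lebesgue_on \<Omega>. s x z = 0" "AE z in lebesgue_on \<Omega>. g y z = 0"
      by (auto intro!: L2_inner_self_eq_0 sL2 gL2)
    then have "x = 0\<^sub>v m" "y = 0\<^sub>v n"
      using s_zero[OF xy(1)] p_zero[OF xy(2)] H10_lincomb_zero_gradient[OF \<Omega>, of "{..<n}" u "\<lambda>i. y $ i"] u
      by (auto simp: p_def g_def)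
    then have "v = 0\<^sub>v m @\<^sub>v 0\<^sub>v n" using xy(3) by metis
    also have "\<dots> = 0\<^sub>v (m + n)" by (intro eq_vecI) auto
    finally show False using v(2) by contradiction
  qed
  have nonneg: "v \<bullet> (N *\<^sub>v v) \<ge> 0" if "v \<in> carrier_vec (m + n)" for v
    using quadN[of "vec_first v m" "vec_last v n"] that L2_inner_self_nonneg by simp
  \<comment> \<open>Independence of the \<open>u i\<close> makes \<open>M\<close> definite, so the
    kernel of \<open>N\<close> consists of the vectors whose last \<open>n\<close> entries vanish.
    The first \<open>m\<close> unit vectors are a basis of it and their own dual family.\<close>
  have "gen_multiplicity_infinity K N = card {..<m}"
    unfolding gen_multiplicity_infinity_def gen_eigenspace_infinity_def carrier_matD(2)[OF K]
  proof (rule dim_mat_kernel_dual_basis[OF N, where b = "unit_vec (m + n)" and f = "unit_vec (m + n)"])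
    fix i assume i: "i \<in> {..<m}"
    have "N *\<^sub>v unit_vec (m + n) i = 0\<^sub>v (m + n)"
      using i carrier by (intro eq_vecI) (auto simp: N_def)
    then show "unit_vec (m + n) i \<in> mat_kernel N"
      by (intro mat_kernelI[OF N]) auto
  next
    fix v k assume v: "v \<in> mat_kernel N" and k: "k < m + n"
    have vc: "v \<in> carrier_vec (m + n)" and Nv: "N *\<^sub>v v = 0\<^sub>v (m + n)"
      using mat_kernelD[OF N v] by auto
    \<comment> \<open>On a kernel vector the quadratic form of \<open>N\<close> vanishes, and this
      form is the squared norm of the function given by the last block.\<close>
    have "L2_inner \<Omega> (p (vec_last v n)) (p (vec_last v n)) = 0"
      using quadN[of "vec_first v m" "vec_last v n"] vc Nv by simp
    then have last0: "vec_last v n = 0\<^sub>v n"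
      by (intro p_zero L2_inner_self_eq_0 pL2) auto
    have "v $ k = 0" if "k \<ge> m"
      using le_add_diff_inverse[OF that] that k vc arg_cong[OF last0, of "\<lambda>y. y $ (k - m)"]
      by (auto simp: vec_last_def)
    then show "v $ k = (\<Sum>i\<in>{..<m}. (unit_vec (m + n) i \<bullet> v) * unit_vec (m + n) i $ k)"
      using vc k by (cases "k < m") (auto simp: scalar_prod_left_unit[OF vc] if_distrib cong: if_cong)
  qed auto
  then have "gen_multiplicity_infinity K N = m" by simp
  \<comment> \<open>The finite eigenvalues are counted by difference: all multiplicities add up to
    \<open>m + n\<close>, and infinity takes \<open>m\<close> of them.\<close>
  with definite_pencil_spectrum[OF K symK N symN pos nonneg] show ?thesis
    by auto
qed

end
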